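(* Let $\alpha>0$, $\delta>0$ and $X\in Par(\alpha,\delta)$. For $s\in\{2,3,\dots\}$ and $k\in\mathbb{N}$ let $X_{(1,n)}\le\dots\le X_{(n,n)}$ be the order statistics of $n=k(s+1)-1$ independent observations on $X$, and define $$Q_{k,s}=\frac{\log\frac{X_{(ks,(s+1)k-1)}}{X_{(k,(s+1)k-1)}}}{H_{ks-1}-H_{k-1}},\qquad Q^*_{k,s}=\frac{\log\frac{X_{(ks,(s+1)k-1)}}{X_{(k,(s+1)k-1)}}}{\log(s)}.$$ Then for every fixed $s=2,3,\dots$, as $k\to\infty$, $$\sqrt{k(s+1)-1}\left[\log\left(\frac{X_{(ks,k(s+1)-1)}}{X_{(k,k(s+1)-1)}}\right)-\frac{1}{\alpha}\log(s)\right]\stackrel{d}{\to}\eta_1,\qquad \eta_1\in N\left(0,\frac{s^2-1}{s\alpha^2}\right),$$ $$\sqrt{k(s+1)-1}\,(H_{ks-1}-H_{k-1})\left[\alpha Q_{k,s}-\frac{\log(s)}{H_{ks-1}-H_{k-1}}\right]\stackrel{d}{\to}\eta_2,\qquad \eta_2\in N\left(0,\frac{s^2-1}{s}\right),$$ $$\sqrt{k(s+1)-1}\left[\alpha Q^*_{k,s}-1\right]\stackrel{d}{\to}\eta_3,\qquad \eta_3\in N\left(0,\frac{s^2-1}{s[\log(s)]^2}\right).$$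
   Context: $X\in Par(\alpha,\delta)$ means that $X$ has c.d.f. $F_X(x)=0$ for $x\le\delta$ and $F_X(x)=1-(\delta/x)^{\alpha}$ for $x>\delta$. $X_{(i,n)}$ denotes the $i$-th smallest of $n$ independent observations on $X$. $\stackrel{d}{\to}$ means convergence in distribution, $\eta\in N(\mu,\sigma^2)$ means that $\eta$ is normally distributed with mean $\mu$ and variance $\sigma^2$, and $\log$ is the natural logarithm. $H_n=\sum_{r=1}^{n} r^{-1}$ is the $n$-th harmonic number, with $H_0=0$. *)

theory Defs
  imports "HOL-Probability.Probability"
begin

definition pareto_rv :: "'a measure \<Rightarrow> real \<Rightarrow> real \<Rightarrow> ('a \<Rightarrow> real) \<Rightarrow> bool" where
  "pareto_rv M \<alpha> \<delta> X \<longleftrightarrow>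
     X \<in> borel_measurable M \<and>
     (\<forall>x. cdf (distr M borel X) x = (if x \<le> \<delta> then 0 else 1 - (\<delta> / x) powr \<alpha>))"

text \<open>The observations are \<open>X 1, \<dots>, X n\<close>; values of \<open>X\<close> outside \<open>{1..n}\<close> are irrelevant.\<close>

definition pareto_sample :: "'a measure \<Rightarrow> real \<Rightarrow> real \<Rightarrow> nat \<Rightarrow> (nat \<Rightarrow> 'a \<Rightarrow> real) \<Rightarrow> bool" where
  "pareto_sample M \<alpha> \<delta> n X \<longleftrightarrow>
     prob_space M \<and>
     prob_space.indep_vars M (\<lambda>_. borel) X {1..n} \<and>
     (\<forall>i\<in>{1..n}. pareto_rv M \<alpha> \<delta> (X i))"

text \<open>\<open>order_stat X i n\<close> is the \<open>i\<close>-th smallest of \<open>X 1, \<dots>, X n\<close>, with \<open>i\<close> counted from 1.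
  It is meaningful only for \<open>1 \<le> i \<le> n\<close>.\<close>

definition order_stat :: "(nat \<Rightarrow> 'a \<Rightarrow> real) \<Rightarrow> nat \<Rightarrow> nat \<Rightarrow> 'a \<Rightarrow> real" where
  "order_stat X i n \<omega> = sort (map (\<lambda>j. X j \<omega>) [1..<Suc n]) ! (i - 1)"

definition Q_stat :: "(nat \<Rightarrow> 'a \<Rightarrow> real) \<Rightarrow> nat \<Rightarrow> nat \<Rightarrow> 'a \<Rightarrow> real" where
  "Q_stat X k s \<omega> =
     ln (order_stat X (k * s) ((s + 1) * k - 1) \<omega> / order_stat X k ((s + 1) * k - 1) \<omega>)
       / (harm (k * s - 1) - harm (k - 1))"

definition Q_star_stat :: "(nat \<Rightarrow> 'a \<Rightarrow> real) \<Rightarrow> nat \<Rightarrow> nat \<Rightarrow> 'a \<Rightarrow> real" where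
  "Q_star_stat X k s \<omega> =
     ln (order_stat X (k * s) ((s + 1) * k - 1) \<omega> / order_stat X k ((s + 1) * k - 1) \<omega>)
       / ln (real s)"

text \<open>The second parameter is the variance, whereas \<^const>\<open>normal_density\<close> takes the
  standard deviation.\<close>

definition normal_law :: "real \<Rightarrow> real \<Rightarrow> real measure" where
  "normal_law \<mu> v = density lborel (normal_density \<mu> (sqrt v))"

end

theory Submission
  imports Defs
begin

text \<open>
  Condition on which observation \<open>X i\<close> is the \<open>k\<close>-th smallest and on the set of the \<open>k - 1\<close>
  observations below it. Each of the other \<open>n - k\<close> observations then exceeds \<open>exp t * X i\<close> with
  probability \<open>exp (- \<alpha> * t)\<close>, whatever the value of \<open>X i\<close>. Hence the log ratio of the \<open>m\<close>-th to
  the \<open>k\<close>-th order statistic is at most \<open>t\<close> exactly with the probability that a binomial variable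
  with parameters \<open>n - k\<close> and \<open>exp (- \<alpha> * t)\<close> is at most \<open>n - m\<close>. For \<open>m = k * s\<close> and
  \<open>t = ln s / \<alpha> + x / sqrt n\<close> the success probability tends to \<open>1 / s\<close>, and the central limit theorem
  for binomial variables with varying parameters gives the normal limit. The three statistics
  differ only by the scale factors \<open>1\<close>, \<open>\<alpha>\<close> and \<open>\<alpha> / ln s\<close>.
\<close>

section \<open>Order statistics\<close>

text \<open>In the sorted list the entries at most \<open>y\<close> form an initial segment, so
  entry \<open>i\<close> is among them exactly when that segment has more than \<open>i\<close>
  elements. Sorting keeps the multiset, hence also the count.\<close>

lemma sort_nth_le_iff:
  fixes y :: "'a::linorder"
  assumes "i < length xs"
  shows "sort xs ! i \<le> y \<longleftrightarrow> i < length (filter (\<lambda>x. x \<le> y) xs)"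
proof -
  define ys where "ys = sort xs"
  have ys: "sorted ys" "i < length ys" using assms by (auto simp: ys_def)
  have "length (filter (\<lambda>x. x \<le> y) xs) = length (filter (\<lambda>x. x \<le> y) ys)"
    unfolding ys_def by (metis mset_filter mset_sort size_mset)
  also have "\<dots> = card {j. j < length ys \<and> ys ! j \<le> y}"
    by (rule length_filter_conv_card)
  finally have len: "length (filter (\<lambda>x. x \<le> y) xs) = card {j. j < length ys \<and> ys ! j \<le> y}" .
  show ?thesis
  proof (cases "ys ! i \<le> y")
    case True
    have "{..i} \<subseteq> {j. j < length ys \<and> ys ! j \<le> y}"
      using ys True by (auto intro: order.trans[OF sorted_nth_mono])
    then have "card {..i} \<le> card {j. j < length ys \<and> ys ! j \<le> y}" by (intro card_mono) auto
    with True show ?thesis by (simp add: len ys_def)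
  next
    case False
    have "{j. j < length ys \<and> ys ! j \<le> y} \<subseteq> {..<i}"
      using ys False by (auto simp: not_le) (meson leD leI less_le_trans sorted_nth_mono)
    then have "card {j. j < length ys \<and> ys ! j \<le> y} \<le> card {..<i}" by (intro card_mono) auto
    with False show ?thesis by (simp add: len ys_def)
  qed
qed

text \<open>Passes from positions in a sorted list to counts of observations below a level, the form
  in which the later events are computed.\<close>

lemma order_stat_le_iff:
  assumes "1 \<le> i" "i \<le> n"
  shows "order_stat X i n \<omega> \<le> y \<longleftrightarrow> i \<le> card {j \<in> {1..n}. X j \<omega> \<le> y}"
proof -
  have "length (filter (\<lambda>x. x \<le> y) (map (\<lambda>j. X j \<omega>) [1..<Suc n])) =
      card (set (filter (\<lambda>j. X j \<omega> \<le> y) [1..<Suc n]))"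
    by (subst distinct_card) (auto simp: filter_map o_def simp del: upt_Suc)
  also have "set (filter (\<lambda>j. X j \<omega> \<le> y) [1..<Suc n]) = {j \<in> {1..n}. X j \<omega> \<le> y}"
    by auto
  finally show ?thesis
    unfolding order_stat_def using assms by (subst sort_nth_le_iff) auto
qed

text \<open>A sublevel set is a finite union, over the index sets of size \<open>i\<close>, of
  finite intersections of sublevel sets of single observations.\<close>

lemma borel_measurable_order_stat:
  assumes i: "1 \<le> i" "i \<le> n" and X[measurable]: "\<And>j. j \<in> {1..n} \<Longrightarrow> X j \<in> borel_measurable M"
  shows "order_stat X i n \<in> borel_measurable M"
proof (rule borel_measurable_iff_le[THEN iffD2], rule allI)
  fix y
  have "{\<omega> \<in> space M. order_stat X i n \<omega> \<le> y} =
      {\<omega> \<in> space M. \<exists>B\<in>{B\<in>Pow {1..n}. card B = i}. \<forall>j\<in>B. X j \<omega> \<le> y}"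
  proof (intro Collect_cong conj_cong refl)
    fix \<omega>
    have "i \<le> card {j \<in> {1..n}. X j \<omega> \<le> y} \<longleftrightarrow> (\<exists>B\<in>{B\<in>Pow {1..n}. card B = i}. \<forall>j\<in>B. X j \<omega> \<le> y)"
    proof
      assume "i \<le> card {j \<in> {1..n}. X j \<omega> \<le> y}"
      then obtain B where "B \<subseteq> {j \<in> {1..n}. X j \<omega> \<le> y}" "card B = i"
        by (meson obtain_subset_with_card_n)
      then show "\<exists>B\<in>{B\<in>Pow {1..n}. card B = i}. \<forall>j\<in>B. X j \<omega> \<le> y" by blast
    next
      assume "\<exists>B\<in>{B\<in>Pow {1..n}. card B = i}. \<forall>j\<in>B. X j \<omega> \<le> y"
      then show "i \<le> card {j \<in> {1..n}. X j \<omega> \<le> y}" by (auto intro!: card_mono)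
    qed
    then show "order_stat X i n \<omega> \<le> y \<longleftrightarrow> (\<exists>B\<in>{B\<in>Pow {1..n}. card B = i}. \<forall>j\<in>B. X j \<omega> \<le> y)"
      using order_stat_le_iff[OF i, of X] by simp
  qed
  also have "\<dots> \<in> sets M"
  proof (rule sets.sets_Collect_finite_Ex)
    fix B assume B: "B \<in> {B \<in> Pow {1..n}. card B = i}"
    then have "finite B" using finite_subset by auto
    then show "{x \<in> space M. \<forall>j\<in>B. X j x \<le> y} \<in> sets M"
    proof (rule sets.sets_Collect_finite_All[rotated])
      fix j assume "j \<in> B"
      then have [measurable]: "X j \<in> borel_measurable M" using B X by auto
      show "{x \<in> space M. X j x \<le> y} \<in> sets M" by measurable
    qed
  qed simp
  finally show "{\<omega> \<in> space M. order_stat X i n \<omega> \<le> y} \<in> sets M" .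
qed

text \<open>The \<open>k\<close> indices in \<open>insert i A\<close> carry values at most
  \<open>X i\<close>. A level strictly below \<open>X i\<close> can be reached by indices in
  \<open>A\<close> only, and these are \<open>k - 1\<close>, one too few.\<close>

lemma order_stat_eqI:
  fixes X :: "nat \<Rightarrow> 'a \<Rightarrow> real"
  assumes i: "i \<in> {1..n}" and A: "A \<subseteq> {1..n} - {i}" "1 \<le> k" "card A = k - 1"
    and lt: "\<And>j. j \<in> A \<Longrightarrow> X j \<omega> < X i \<omega>"
    and gt: "\<And>j. j \<in> {1..n} - {i} - A \<Longrightarrow> X i \<omega> < X j \<omega>"
  shows "order_stat X k n \<omega> = X i \<omega>"
proof (rule antisym)
  have finA: "finite A" using A finite_subset by blast
  have "card A \<le> n - 1" using card_mono[OF _ A(1)] i by auto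
  then have k: "1 \<le> k" "k \<le> n" using A i by auto
  have "card (insert i A) \<le> card {j \<in> {1..n}. X j \<omega> \<le> X i \<omega>}"
    using i A lt by (intro card_mono) (auto intro: less_imp_le)
  moreover have "card (insert i A) = k" using A finA by (subst card_insert_disjoint) auto
  ultimately show "order_stat X k n \<omega> \<le> X i \<omega>" using order_stat_le_iff[OF k, of X] by simp
  show "X i \<omega> \<le> order_stat X k n \<omega>"
  proof (rule ccontr)
    assume less: "\<not> X i \<omega> \<le> order_stat X k n \<omega>"
    have "k \<le> card {j \<in> {1..n}. X j \<omega> \<le> order_stat X k n \<omega>}"
      using order_stat_le_iff[OF k, of X \<omega> "order_stat X k n \<omega>"] by simp
    also have "\<dots> \<le> card A"
    proof (rule card_mono[OF finA], rule subsetI)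
      fix j assume j: "j \<in> {j \<in> {1..n}. X j \<omega> \<le> order_stat X k n \<omega>}"
      with gt[of j] less show "j \<in> A" by fastforce
    qed
    finally show False using A k by simp
  qed
qed

text \<open>Injectivity excludes ties, which could make the number of observations strictly below
  the \<open>k\<close>-th smallest value drop under \<open>k - 1\<close>. It is used to show that
  the configurations below exhaust the sample space up to a null set.\<close>

lemma ex_order_stat_index:
  fixes X :: "nat \<Rightarrow> 'a \<Rightarrow> real"
  assumes k: "1 \<le> k" "k \<le> n" and inj: "inj_on (\<lambda>j. X j \<omega>) {1..n}"
  obtains i where "i \<in> {1..n}" "card {j \<in> {1..n}. X j \<omega> < X i \<omega>} = k - 1"
proof -
  have "order_stat X k n \<omega> \<in> set (sort (map (\<lambda>j. X j \<omega>) [1..<Suc n]))"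
    unfolding order_stat_def using k by (intro nth_mem) auto
  then obtain i where i: "i \<in> {1..n}" "order_stat X k n \<omega> = X i \<omega>" by (auto simp: less_Suc_eq_le simp del: upt_Suc)
  define A where "A = {j \<in> {1..n}. X j \<omega> < X i \<omega>}"
  have A: "finite A" "i \<notin> A" by (auto simp: A_def)
  have "{j \<in> {1..n}. X j \<omega> \<le> X i \<omega>} = insert i A"
    using i inj by (auto simp: A_def less_le dest: inj_onD)
  then have 1: "k \<le> Suc (card A)"
    using order_stat_le_iff[OF k, of X \<omega> "X i \<omega>"] i A by simp
  have 2: "card A < k"
  proof (rule ccontr)
    assume c: "\<not> card A < k"
    \<comment> \<open>If \<open>A\<close> had at least \<open>k\<close> elements, its largest value
      would already bound the \<open>k\<close>-th order statistic, although it lies strictly below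
      \<open>X i\<close>.\<close>
    define y where "y = Max ((\<lambda>j. X j \<omega>) ` A)"
    have ne: "A \<noteq> {}" using c k by auto
    have "A \<subseteq> {j \<in> {1..n}. X j \<omega> \<le> y}" using A by (auto simp: y_def A_def)
    then have "card A \<le> card {j \<in> {1..n}. X j \<omega> \<le> y}" by (intro card_mono) auto
    then have "order_stat X k n \<omega> \<le> y" using c order_stat_le_iff[OF k, of X] by simp
    moreover have "y < X i \<omega>" unfolding y_def using ne A by (subst Max_less_iff) (auto simp: A_def)
    ultimately show False using i by simp
  qed
  show ?thesis by (rule that[OF i(1)]) (use 1 2 in \<open>simp add: A_def\<close>)
qed

section \<open>The conditional binomial law\<close>

text \<open>This is conditioning on \<open>X i\<close> by means of Fubini: the joint law is a
  product measure, and once the coordinate \<open>i\<close> is fixed the remaining constraints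
  concern separate independent coordinates.\<close>

lemma (in prob_space) emeasure_indep_conditioned:
  fixes X :: "'i \<Rightarrow> 'a \<Rightarrow> real"
  assumes I: "finite I" "i \<notin> I"
    and indep: "indep_vars (\<lambda>_. borel) X (insert i I)"
    and D: "\<And>j. j \<in> insert i I \<Longrightarrow> distr M borel (X j) = D"
    and P: "\<And>j. j \<in> I \<Longrightarrow> Measurable.pred (borel \<Otimes>\<^sub>M borel) (case_prod (P j))"
  shows "emeasure M {\<omega> \<in> space M. \<forall>j\<in>I. P j (X i \<omega>) (X j \<omega>)} =
    (\<integral>\<^sup>+x. (\<Prod>j\<in>I. emeasure D {y. P j x y}) \<partial>D)"
proof -
  have X: "random_variable borel (X j)" if "j \<in> insert i I" for j
    using indep that unfolding indep_vars_def by auto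
  interpret D: prob_space D
    using D[of i] X[of i] by (auto intro: prob_space_distr)
  have sD[measurable_cong, simp]: "sets D = sets borel" and spD[simp]: "space D = UNIV"
    using D[of i] by (auto simp flip: D)
  interpret PD: product_prob_space "\<lambda>_. D" "insert i I" ..
  let ?P = "Pi\<^sub>M (insert i I) (\<lambda>_. D)"
  let ?B = "Pi\<^sub>M (insert i I) (\<lambda>_. borel :: real measure)"
  let ?X = "\<lambda>\<omega>. \<lambda>j\<in>insert i I. X j \<omega>"
  let ?E = "{f \<in> space ?P. \<forall>j\<in>I. P j (f i) (f j)}"
  have X'[measurable]: "?X \<in> measurable M ?B"
    by (rule measurable_restrict) (use X in auto)
  have setsB: "sets ?B = sets ?P" by (rule sets_PiM_cong) auto
  have "distr M ?B ?X = (\<Pi>\<^sub>M j\<in>insert i I. distr M borel (X j))"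
    using indep_vars_iff_distr_eq_PiM'[of "insert i I" X "\<lambda>_. borel", OF _ X] indep by simp
  also have "\<dots> = ?P" by (rule PiM_cong) (use D in auto)
  finally have distr: "distr M ?B ?X = ?P" .
  have E[measurable]: "?E \<in> sets ?P"
  proof (rule sets.sets_Collect_finite_All)
    fix j assume j: "j \<in> I"
    have [measurable]: "Measurable.pred (borel \<Otimes>\<^sub>M borel) (case_prod (P j))" by (rule P[OF j])
    have [measurable]: "(\<lambda>f. f j) \<in> measurable ?P borel" "(\<lambda>f. f i) \<in> measurable ?P borel"
      using measurable_component_singleton[of _ "insert i I" "\<lambda>_. D"] j
      by (auto simp: measurable_cong_sets[OF refl sD])
    have "Measurable.pred ?P (\<lambda>f. case_prod (P j) (f i, f j))" by measurable
    then show "{f \<in> space ?P. P j (f i) (f j)} \<in> sets ?P" by (simp add: pred_def)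
  qed (use I in auto)
  have spB: "space ?B = space ?P" by (simp add: space_PiM)
  have "emeasure M {\<omega> \<in> space M. \<forall>j\<in>I. P j (X i \<omega>) (X j \<omega>)} = emeasure M (?X -` ?E \<inter> space M)"
    using I by (intro arg_cong[where f="emeasure M"]) (auto simp: space_PiM PiE_def Pi_def)
  also have "\<dots> = emeasure (distr M ?B ?X) ?E"
    by (subst emeasure_distr) (use setsB E in auto)
  also have "\<dots> = (\<integral>\<^sup>+f. indicator ?E f \<partial>?P)" by (subst distr, subst nn_integral_indicator) auto
  also have "\<dots> = (\<integral>\<^sup>+y. (\<integral>\<^sup>+f. indicator ?E (f(i := y)) \<partial>(Pi\<^sub>M I (\<lambda>_. D))) \<partial>D)"
    by (rule PD.product_nn_integral_insert_rev) (use I in auto)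
  also have "\<dots> = (\<integral>\<^sup>+y. (\<Prod>j\<in>I. emeasure D {z. P j y z}) \<partial>D)"
  proof (rule nn_integral_cong)
    fix y
    have m: "{z. P j y z} \<in> sets D" if "j \<in> I" for j
    proof -
      have [measurable]: "Measurable.pred (borel \<Otimes>\<^sub>M borel) (case_prod (P j))" by (rule P[OF that])
      have "Measurable.pred borel (\<lambda>z. case_prod (P j) (y, z))" by measurable
      then show ?thesis by (simp add: pred_def)
    qed
    \<comment> \<open>With coordinate \<open>i\<close> set to \<open>y\<close>, the event is a box
      in the other coordinates, and its measure is a product.\<close>
    have "(\<integral>\<^sup>+f. indicator ?E (f(i := y)) \<partial>(Pi\<^sub>M I (\<lambda>_. D))) =
        (\<integral>\<^sup>+f. indicator (PiE I (\<lambda>j. {z. P j y z})) f \<partial>(Pi\<^sub>M I (\<lambda>_. D)))"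
      using I by (intro nn_integral_cong)
        (auto simp: indicator_def space_PiM PiE_iff extensional_def split: if_splits)
    also have "\<dots> = emeasure (Pi\<^sub>M I (\<lambda>_. D)) (PiE I (\<lambda>j. {z. P j y z}))"
      using m I by (intro nn_integral_indicator sets_PiM_I_finite) auto
    also have "\<dots> = (\<Prod>j\<in>I. emeasure D {z. P j y z})"
      by (rule PD.emeasure_PiM) (use I m in auto)
    finally show "(\<integral>\<^sup>+f. indicator ?E (f(i := y)) \<partial>(Pi\<^sub>M I (\<lambda>_. D))) =
        (\<Prod>j\<in>I. emeasure D {z. P j y z})" .
  qed
  finally show ?thesis .
qed

text \<open>The binomial coefficient counts the sets of successful trials. Spreading the mass over
  these sets gives one summand for each choice of \<open>B\<close> in the configurations
  below.\<close>

lemma measure_binomial_pmf_eq_sum_subsets: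
  assumes "finite C" "p \<in> {0..1}"
  shows "measure (binomial_pmf (card C) p) L =
    (\<Sum>B | B \<subseteq> C \<and> card B \<in> L. p ^ card B * (1 - p) ^ (card C - card B))"
proof -
  let ?b = "binomial_pmf (card C) p"
  have fin: "finite {B. B \<subseteq> C \<and> card B \<in> L}" using assms by auto
  have "measure ?b L = measure ?b (L \<inter> {..card C})"
    using assms by (intro measure_pmf.finite_measure_eq_AE)
      (auto simp: AE_measure_pmf_iff set_pmf_binomial_eq split: if_splits)
  also have "\<dots> = (\<Sum>l\<in>L \<inter> {..card C}. pmf ?b l)"
    by (rule measure_measure_pmf_finite) auto
  also have "\<dots> = (\<Sum>l\<in>L \<inter> {..card C}. \<Sum>B\<in>{B \<in> {B. B \<subseteq> C \<and> card B \<in> L}. card B = l}.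
      p ^ card B * (1 - p) ^ (card C - card B))"
  proof (rule sum.cong[OF refl])
    fix l assume l: "l \<in> L \<inter> {..card C}"
    have "{B \<in> {B. B \<subseteq> C \<and> card B \<in> L}. card B = l} = {B. B \<subseteq> C \<and> card B = l}" using l by auto
    then show "pmf ?b l = (\<Sum>B\<in>{B \<in> {B. B \<subseteq> C \<and> card B \<in> L}. card B = l}.
      p ^ card B * (1 - p) ^ (card C - card B))"
      using assms by (simp add: n_subsets)
  qed
  also have "\<dots> = (\<Sum>B | B \<subseteq> C \<and> card B \<in> L. p ^ card B * (1 - p) ^ (card C - card B))"
    by (rule sum.group[OF fin]) (use assms in \<open>auto intro: card_mono\<close>)
  finally show ?thesis .
qed

text \<open>Given \<open>X i = x\<close>, an observation above \<open>x\<close> exceeds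
  \<open>g x\<close> with conditional probability \<open>p\<close>, which by \<open>tail\<close> is
  the same for almost all \<open>x\<close>. Every configuration therefore has as probability a
  common constant times a binomial weight. The Pareto law will enter only through the verification
  of \<open>tail\<close>.\<close>

lemma (in prob_space) prob_order_stat_le_order_stat:
  fixes X :: "nat \<Rightarrow> 'a \<Rightarrow> real" and g :: "real \<Rightarrow> real"
  assumes k: "1 \<le> k" "k < m" "m \<le> n"
    and indep: "indep_vars (\<lambda>_. borel) X {1..n}"
    and D: "\<And>j. j \<in> {1..n} \<Longrightarrow> distr M borel (X j) = D"
    and no_atoms: "\<And>x. emeasure D {x} = 0"
    and g[measurable]: "g \<in> borel_measurable borel" and g_ge: "AE x in D. x \<le> g x"
    and tail: "AE x in D. measure D {g x<..} = p * measure D {x<..}"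
    and p: "p \<in> {0..1}"
  shows "prob {\<omega> \<in> space M. order_stat X m n \<omega> \<le> g (order_stat X k n \<omega>)} =
    measure (binomial_pmf (n - k) p) {..n - m}"
proof -
  have X[measurable]: "random_variable borel (X j)" if "j \<in> {1..n}" for j
    using indep that unfolding indep_vars_def by auto
  interpret D: prob_space D
    using D[of 1] X[of 1] k by (auto intro: prob_space_distr)
  have sD[measurable_cong, simp]: "sets D = sets borel" and spD[simp]: "space D = UNIV"
    using D[of 1] k by (auto simp flip: D)

  \<comment> \<open>In the configuration \<open>(i, A, B)\<close>, \<open>X i\<close> is the \<open>k\<close>-th smallest observation, \<open>A\<close> indexes the
    observations below \<open>X i\<close>, and \<open>B\<close> those above \<open>g (X i)\<close>.\<close>
  define P where "P A B j x y \<longleftrightarrow>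
      (if j \<in> A then y < x else if j \<in> B then x < y \<and> g x < y else x < y \<and> y \<le> g x)"
    for A B :: "nat set" and j :: nat and x y
  define E where "E = (\<lambda>(i, A, B). {\<omega> \<in> space M. \<forall>j\<in>{1..n} - {i}. P A B j (X i \<omega>) (X j \<omega>)})"
  define T where "T L = (SIGMA i:{1..n}. SIGMA A:{A. A \<subseteq> {1..n} - {i} \<and> card A = k - 1}.
      {B. B \<subseteq> {1..n} - {i} - A \<and> card B \<in> L})" for L
  have finT: "finite (T L)" for L
    unfolding T_def by (intro finite_SigmaI) auto
  have Pm: "Measurable.pred (borel \<Otimes>\<^sub>M borel) (case_prod (P A B j))" for A B j
    unfolding P_def split_beta' by measurable
  have Em: "E t \<in> events" if "t \<in> T L" for t L
  proof -
    obtain i A B where t: "t = (i, A, B)" by (metis prod_cases3)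
    then have i: "i \<in> {1..n}" using that by (auto simp: T_def)
    have "{\<omega> \<in> space M. \<forall>j\<in>{1..n} - {i}. P A B j (X i \<omega>) (X j \<omega>)} \<in> events"
    proof (rule sets.sets_Collect_finite_All)
      fix j assume "j \<in> {1..n} - {i}"
      with i have [measurable]: "X i \<in> borel_measurable M" "X j \<in> borel_measurable M" by auto
      note Pm[of A B j, measurable]
      have "Measurable.pred M (\<lambda>\<omega>. case_prod (P A B j) (X i \<omega>, X j \<omega>))" by measurable
      then show "{\<omega> \<in> space M. P A B j (X i \<omega>) (X j \<omega>)} \<in> events" by (simp add: pred_def)
    qed auto
    then show ?thesis by (simp add: E_def t)
  qed

  \<comment> \<open>The constant \<open>c\<close> is never evaluated: summing over all configurations identifies it by
    normalisation.\<close>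
  define c where "c = (\<integral>\<^sup>+x. ennreal (measure D {..<x} ^ (k - 1) * measure D {x<..} ^ (n - k)) \<partial>D)"
  \<comment> \<open>The integrand is at most 1 and \<open>D\<close> has total mass 1, so
    \<open>c\<close> is finite and \<open>enn2real\<close> loses nothing.\<close>
  have "c \<le> (\<integral>\<^sup>+x. 1 \<partial>D)"
    unfolding c_def by (intro nn_integral_mono)
      (auto intro!: mult_le_one power_le_one simp: ennreal_le_1)
  then have c: "ennreal (enn2real c) = c"
    by (subst ennreal_enn2real) (auto simp: D.emeasure_space_1 less_top[symmetric] top_unique)

  have prob_E: "prob (E (i, A, B)) = enn2real c * (p ^ card B * (1 - p) ^ (n - k - card B))"
    if t: "(i, A, B) \<in> T UNIV" for i A B
  proof -
    let ?I = "{1..n} - {i}"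
    from t have i: "i \<in> {1..n}" and A: "A \<subseteq> ?I" "card A = k - 1" and B: "B \<subseteq> ?I - A"
      by (auto simp: T_def)
    have fin: "finite A" "finite B" using A B by (meson finite_Diff finite_atLeastAtMost finite_subset)+
    define C where "C = ?I - A - B"
    have I: "?I = A \<union> (B \<union> C)" "A \<inter> (B \<union> C) = {}" "B \<inter> C = {}" "finite C"
      using A B by (auto simp: C_def)
    have "card ?I = card A + (card B + card C)"
      unfolding I(1) using fin I by (subst card_Un_disjoint, simp, simp, simp)+ simp
    then have cardC: "card C = n - k - card B" "card B + card C = n - k"
      using i A(2) k by auto
    have ins: "insert i ?I = {1..n}" using i by auto
    have "emeasure M (E (i, A, B)) = (\<integral>\<^sup>+x. (\<Prod>j\<in>?I. emeasure D {y. P A B j x y}) \<partial>D)"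
      unfolding E_def prod.case
      by (rule emeasure_indep_conditioned[OF _ _ _ _ Pm]) (use i ins indep D in auto)
    also have "\<dots> = (\<integral>\<^sup>+x. ennreal (p ^ card B * (1 - p) ^ (n - k - card B)) *
        ennreal (measure D {..<x} ^ (k - 1) * measure D {x<..} ^ (n - k)) \<partial>D)"
    proof (rule nn_integral_cong_AE)
      show "AE x in D. (\<Prod>j\<in>?I. emeasure D {y. P A B j x y}) =
          ennreal (p ^ card B * (1 - p) ^ (n - k - card B)) *
          ennreal (measure D {..<x} ^ (k - 1) * measure D {x<..} ^ (n - k))"
        using g_ge tail
      proof eventually_elim
        fix x assume gx: "x \<le> g x" and tx: "measure D {g x<..} = p * measure D {x<..}"
        \<comment> \<open>The mass above \<open>x\<close> is split at \<open>g x\<close> into the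
          fractions \<open>p\<close> and \<open>1 - p\<close>. Indices in \<open>B\<close>
          contribute the former and indices in \<open>C\<close> the latter.\<close>
        have "measure D {x<..} = measure D ({x<..g x} \<union> {g x<..})"
          using gx by (intro arg_cong[where f="measure D"]) auto
        also have "\<dots> = measure D {x<..g x} + measure D {g x<..}"
          by (rule D.finite_measure_Union) auto
        finally have mx: "measure D {x<..g x} = (1 - p) * measure D {x<..}"
          using tx by (simp add: algebra_simps)
        have "(\<Prod>j\<in>?I. emeasure D {y. P A B j x y}) = ennreal (\<Prod>j\<in>?I. measure D {y. P A B j x y})"
          by (simp add: D.emeasure_eq_measure prod_ennreal)
        also have "(\<Prod>j\<in>?I. measure D {y. P A B j x y}) =
            (\<Prod>j\<in>A. measure D {..<x}) * ((\<Prod>j\<in>B. measure D {g x<..}) * (\<Prod>j\<in>C. measure D {x<..g x}))"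
        proof -
          have "(\<Prod>j\<in>A. measure D {y. P A B j x y}) = (\<Prod>j\<in>A. measure D {..<x})"
            by (intro prod.cong refl arg_cong[where f="measure D"]) (auto simp: P_def)
          moreover have "(\<Prod>j\<in>B. measure D {y. P A B j x y}) = (\<Prod>j\<in>B. measure D {g x<..})"
            using B gx by (intro prod.cong refl arg_cong[where f="measure D"]) (auto simp: P_def)
          moreover have "(\<Prod>j\<in>C. measure D {y. P A B j x y}) = (\<Prod>j\<in>C. measure D {x<..g x})"
            by (intro prod.cong refl arg_cong[where f="measure D"]) (auto simp: P_def C_def)
          moreover have "(\<Prod>j\<in>?I. measure D {y. P A B j x y}) = (\<Prod>j\<in>A. measure D {y. P A B j x y}) *
              ((\<Prod>j\<in>B. measure D {y. P A B j x y}) * (\<Prod>j\<in>C. measure D {y. P A B j x y}))"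
            unfolding I(1) using fin I by (subst prod.union_disjoint, simp, simp, simp)+ simp
          ultimately show ?thesis by simp
        qed
        also have "\<dots> = (p ^ card B * (1 - p) ^ card C) *
            (measure D {..<x} ^ (k - 1) * measure D {x<..} ^ (card B + card C))"
          using A(2) by (simp add: mx tx power_mult_distrib power_add)
        also have "\<dots> = (p ^ card B * (1 - p) ^ (n - k - card B)) *
            (measure D {..<x} ^ (k - 1) * measure D {x<..} ^ (n - k))"
          unfolding cardC(2) unfolding cardC(1) ..
        finally show "(\<Prod>j\<in>?I. emeasure D {y. P A B j x y}) =
          ennreal (p ^ card B * (1 - p) ^ (n - k - card B)) *
          ennreal (measure D {..<x} ^ (k - 1) * measure D {x<..} ^ (n - k))"
          using p by (simp add: ennreal_mult')
      qed
    qed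
    also have "\<dots> = ennreal (p ^ card B * (1 - p) ^ (n - k - card B)) * c"
      unfolding c_def
    proof (rule nn_integral_cmult)
      \<comment> \<open>The mass below \<open>x\<close> is increasing and the mass above
        \<open>x\<close> decreasing in \<open>x\<close>. Monotone functions are Borel, so the second
        is treated through its negative.\<close>
      have "(\<lambda>x. measure D {..<x}) \<in> borel_measurable borel"
        by (intro borel_measurable_mono monoI D.finite_measure_mono) auto
      moreover have "(\<lambda>x. - measure D {x<..}) \<in> borel_measurable borel"
        by (intro borel_measurable_mono monoI) (auto intro!: D.finite_measure_mono)
      then have "(\<lambda>x. - (- measure D {x<..})) \<in> borel_measurable borel"
        by (rule borel_measurable_uminus)
      ultimately show "(\<lambda>x. ennreal (measure D {..<x} ^ (k - 1) * measure D {x<..} ^ (n - k)))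
          \<in> borel_measurable D"
        by simp
    qed
    also have "\<dots> = ennreal (p ^ card B * (1 - p) ^ (n - k - card B) * enn2real c)"
      using p by (simp add: ennreal_mult' c)
    finally show ?thesis using p by (simp add: measure_def mult.commute)
  qed

  \<comment> \<open>An outcome determines its configuration. The first three facts hold even where
    \<open>g x < x\<close>, since \<open>P\<close> demands \<open>x < y\<close> separately for all
    indices outside \<open>A\<close>; thus the events are disjoint everywhere and not only up to
    null sets. Only the last fact assumes \<open>X i \<le> g (X i)\<close>.\<close>
  have E_A: "A = {j \<in> {1..n}. X j \<omega> < X i \<omega>}"
    and E_B: "B = {j \<in> {1..n}. X i \<omega> < X j \<omega> \<and> g (X i \<omega>) < X j \<omega>}"
    and E_k: "order_stat X k n \<omega> = X i \<omega>"
    and E_m: "X i \<omega> \<le> g (X i \<omega>) \<Longrightarrow> order_stat X m n \<omega> \<le> g (X i \<omega>) \<longleftrightarrow> card B \<le> n - m"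
    if "(i, A, B) \<in> T UNIV" "\<omega> \<in> E (i, A, B)" for i A B \<omega>
  proof -
    from that(1) have t: "i \<in> {1..n}" "A \<subseteq> {1..n} - {i}" "card A = k - 1" "B \<subseteq> {1..n} - {i} - A"
      by (auto simp: T_def)
    have PE: "P A B j (X i \<omega>) (X j \<omega>)" if "j \<in> {1..n} - {i}" for j
      using \<open>\<omega> \<in> E (i, A, B)\<close> that by (auto simp: E_def)
    have lt: "X j \<omega> < X i \<omega>" if "j \<in> A" for j
    proof -
      have "j \<in> {1..n} - {i}" using that t by blast
      from PE[OF this] that show ?thesis by (simp add: P_def)
    qed
    have gt: "X i \<omega> < X j \<omega> \<and> g (X i \<omega>) < X j \<omega>" if "j \<in> B" for j
    proof -
      have "j \<in> {1..n} - {i}" "j \<notin> A" using that t by blast+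
      from PE[OF this(1)] this(2) that show ?thesis by (simp add: P_def)
    qed
    have mid: "X i \<omega> < X j \<omega> \<and> X j \<omega> \<le> g (X i \<omega>)" if "j \<in> {1..n} - {i} - A - B" for j
      using PE[of j] that by (auto simp: P_def)
    have sub: "A \<subseteq> {1..n}" "B \<subseteq> {1..n}" "i \<notin> A" "i \<notin> B" "A \<inter> B = {}" using t by auto
    have cases: "j = i \<or> j \<in> A \<and> X j \<omega> < X i \<omega> \<or> j \<in> B \<and> X i \<omega> < X j \<omega> \<and> g (X i \<omega>) < X j \<omega> \<or>
        j \<notin> A \<and> j \<notin> B \<and> X i \<omega> < X j \<omega> \<and> X j \<omega> \<le> g (X i \<omega>)" if "j \<in> {1..n}" for j
      using that lt[of j] gt[of j] mid[of j]
      by (cases "j = i"; cases "j \<in> A"; cases "j \<in> B") (simp_all del: One_nat_def)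
    show A: "A = {j \<in> {1..n}. X j \<omega> < X i \<omega>}"
    proof (rule set_eqI)
      fix j show "j \<in> A \<longleftrightarrow> j \<in> {j \<in> {1..n}. X j \<omega> < X i \<omega>}"
        using cases[of j] sub by (cases "j \<in> {1..n}") (auto simp del: One_nat_def)
    qed
    show B: "B = {j \<in> {1..n}. X i \<omega> < X j \<omega> \<and> g (X i \<omega>) < X j \<omega>}"
    proof (rule set_eqI)
      fix j show "j \<in> B \<longleftrightarrow> j \<in> {j \<in> {1..n}. X i \<omega> < X j \<omega> \<and> g (X i \<omega>) < X j \<omega>}"
        using cases[of j] sub by (cases "j \<in> {1..n}") (auto simp del: One_nat_def)
    qed
    show "order_stat X k n \<omega> = X i \<omega>"
    proof (rule order_stat_eqI[of i n A])
      fix j assume "j \<in> {1..n} - {i} - A"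
      then show "X i \<omega> < X j \<omega>" using gt[of j] mid[of j] by (cases "j \<in> B") auto
    next
      fix j assume "j \<in> A"
      then show "X j \<omega> < X i \<omega>" by (rule lt)
    qed (use k t in auto)
    assume g: "X i \<omega> \<le> g (X i \<omega>)"
    \<comment> \<open>For \<open>i\<close> and the indices in \<open>A\<close> this uses the
      assumption on \<open>g\<close> just made. Since \<open>card B\<close> and \<open>m\<close> are
      both at most \<open>n\<close>, the truncated differences are genuine ones.\<close>
    have "{j \<in> {1..n}. X j \<omega> \<le> g (X i \<omega>)} = {1..n} - B"
    proof (rule set_eqI)
      fix j show "j \<in> {j \<in> {1..n}. X j \<omega> \<le> g (X i \<omega>)} \<longleftrightarrow> j \<in> {1..n} - B"
        using cases[of j] sub g t(1) by (cases "j \<in> {1..n}") (auto simp del: One_nat_def)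
    qed
    moreover have "B \<subseteq> {1..n}" "finite B" using t(4) by (auto intro: finite_subset)
    then have "card ({1..n} - B) = n - card B" "card B \<le> n"
      using card_mono[of "{1..n}" B] by (auto simp: card_Diff_subset)
    ultimately have "card {j \<in> {1..n}. X j \<omega> \<le> g (X i \<omega>)} = n - card B" "card B \<le> n" by simp_all
    moreover have "order_stat X m n \<omega> \<le> g (X i \<omega>) \<longleftrightarrow> m \<le> card {j \<in> {1..n}. X j \<omega> \<le> g (X i \<omega>)}"
      using k by (intro order_stat_le_iff) auto
    ultimately show "order_stat X m n \<omega> \<le> g (X i \<omega>) \<longleftrightarrow> card B \<le> n - m"
      using k by auto
  qed

  \<comment> \<open>Ties are null events: given the value of \<open>X i\<close>, another observation
    takes that same value with probability 0, as \<open>D\<close> has no atoms.\<close>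
  have "AE \<omega> in M. \<forall>i\<in>{1..n}. \<forall>j\<in>{1..n}. i \<noteq> j \<longrightarrow> X i \<omega> \<noteq> X j \<omega>"
  proof (intro AE_finite_allI finite_atLeastAtMost)
    fix i j assume ij: "i \<in> {1..n}" "j \<in> {1..n}"
    show "AE \<omega> in M. i \<noteq> j \<longrightarrow> X i \<omega> \<noteq> X j \<omega>"
    proof (cases "i = j")
      case False
      have [measurable]: "X i \<in> borel_measurable M" "X j \<in> borel_measurable M" using ij by auto
      have "emeasure M {\<omega> \<in> space M. \<forall>j\<in>{j}. X j \<omega> = X i \<omega>} =
          (\<integral>\<^sup>+x. (\<Prod>j\<in>{j}. emeasure D {y. y = x}) \<partial>D)"
        by (rule emeasure_indep_conditioned[where P="\<lambda>_ x y. y = x"])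
          (use ij False D in \<open>auto intro: indep_vars_subset[OF indep]\<close>)
      also have "\<dots> = 0" using no_atoms by simp
      finally have "emeasure M {\<omega> \<in> space M. X j \<omega> = X i \<omega>} = 0" by simp
      then have "AE \<omega> in M. X j \<omega> \<noteq> X i \<omega>"
        by (subst AE_iff_measurable[OF _ refl]) simp_all
      then show ?thesis by eventually_elim auto
    qed simp
  qed
  moreover have "AE \<omega> in M. \<forall>i\<in>{1..n}. X i \<omega> \<le> g (X i \<omega>)"
  proof (intro AE_finite_allI finite_atLeastAtMost)
    fix i assume i: "i \<in> {1..n}"
    show "AE \<omega> in M. X i \<omega> \<le> g (X i \<omega>)"
      by (rule AE_distrD[OF X[OF i]]) (simp only: D[OF i] g_ge)
  qed
  ultimately have good: "AE \<omega> in M. inj_on (\<lambda>j. X j \<omega>) {1..n} \<and> (\<forall>i\<in>{1..n}. X i \<omega> \<le> g (X i \<omega>))"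
    by eventually_elim (auto simp: inj_on_def)

  have T_UNIV: "t \<in> T UNIV" if "t \<in> T L" for t L using that by (auto simp: T_def)
  \<comment> \<open>For fixed \<open>i\<close> and \<open>A\<close>, summing over \<open>B\<close>
    yields the binomial probability of \<open>L\<close>. The remaining factor \<open>K\<close> is
    the same for all \<open>L\<close>, which allows it to be found from
    \<open>L = UNIV\<close>.\<close>
  define K where "K = (\<Sum>i\<in>{1..n}. \<Sum>A | A \<subseteq> {1..n} - {i} \<and> card A = k - 1. enn2real c)"
  have prob_T: "prob (\<Union>t\<in>T L. E t) = K * measure (binomial_pmf (n - k) p) L" for L
  proof -
    have "disjoint_family_on E (T L)"
      unfolding disjoint_family_on_def
    proof (intro ballI impI)
      fix t t' assume t: "t \<in> T L" "t' \<in> T L" "t \<noteq> t'"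
      obtain i A B where eq: "t = (i, A, B)" by (metis prod_cases3)
      obtain i' A' B' where eq': "t' = (i', A', B')" by (metis prod_cases3)
      show "E t \<inter> E t' = {}"
      proof (rule ccontr)
        assume "E t \<inter> E t' \<noteq> {}"
        then obtain \<omega> where w: "\<omega> \<in> E (i, A, B)" "\<omega> \<in> E (i', A', B')" using eq eq' by auto
        have T: "(i, A, B) \<in> T UNIV" "(i', A', B') \<in> T UNIV" using t T_UNIV eq eq' by auto
        have X: "X i \<omega> = X i' \<omega>" using E_k[OF T(1) w(1)] E_k[OF T(2) w(2)] by simp
        \<comment> \<open>\<open>P\<close> forces a strict inequality between \<open>X i\<close> and
          every other observation, so equal values imply equal indices.\<close>
        have "i = i'"
        proof (rule ccontr)
          assume "i \<noteq> i'"
          then have "P A B i' (X i \<omega>) (X i' \<omega>)" using w T by (auto simp: E_def T_def)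
          then show False using X by (auto simp: P_def split: if_splits)
        qed
        then have "t = t'" using E_A[OF T(1) w(1)] E_A[OF T(2) w(2)] E_B[OF T(1) w(1)] E_B[OF T(2) w(2)]
          by (simp add: eq eq')
        with t show False by simp
      qed
    qed
    then have "prob (\<Union>t\<in>T L. E t) = (\<Sum>t\<in>T L. prob (E t))"
      using finT Em by (intro finite_measure_finite_Union) auto
    also have "\<dots> = (\<Sum>(i, A, B)\<in>T L. enn2real c * (p ^ card B * (1 - p) ^ (n - k - card B)))"
      using T_UNIV prob_E by (intro sum.cong) auto
    also have "\<dots> = (\<Sum>i\<in>{1..n}. \<Sum>A | A \<subseteq> {1..n} - {i} \<and> card A = k - 1.
        \<Sum>B | B \<subseteq> {1..n} - {i} - A \<and> card B \<in> L. enn2real c * (p ^ card B * (1 - p) ^ (n - k - card B)))"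
      unfolding T_def by (subst sum.Sigma[symmetric], simp, simp)+ (simp add: split_def)
    also have "\<dots> = (\<Sum>i\<in>{1..n}. \<Sum>A | A \<subseteq> {1..n} - {i} \<and> card A = k - 1.
        enn2real c * measure (binomial_pmf (n - k) p) L)"
    proof (intro sum.cong refl)
      fix i A assume i: "i \<in> {1..n}" and A: "A \<in> {A. A \<subseteq> {1..n} - {i} \<and> card A = k - 1}"
      then have "card ({1..n} - {i} - A) = n - k"
        using k by (subst card_Diff_subset) (auto intro: finite_subset)
      then show "(\<Sum>B | B \<subseteq> {1..n} - {i} - A \<and> card B \<in> L.
          enn2real c * (p ^ card B * (1 - p) ^ (n - k - card B))) =
          enn2real c * measure (binomial_pmf (n - k) p) L"
        using measure_binomial_pmf_eq_sum_subsets[of "{1..n} - {i} - A" p L] p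
        by (simp add: sum_distrib_left)
    qed
    finally show ?thesis by (simp add: K_def sum_distrib_right mult.assoc)
  qed

  \<comment> \<open>In the absence of ties, the configuration is read off from the outcome
    itself.\<close>
  have ex: "AE \<omega> in M. \<exists>i A B. (i, A, B) \<in> T UNIV \<and> \<omega> \<in> E (i, A, B) \<and> X i \<omega> \<le> g (X i \<omega>)"
    using good AE_space
  proof eventually_elim
    fix \<omega> assume w: "inj_on (\<lambda>j. X j \<omega>) {1..n} \<and> (\<forall>i\<in>{1..n}. X i \<omega> \<le> g (X i \<omega>))" "\<omega> \<in> space M"
    have "1 \<le> k" "k \<le> n" using k by auto
    then obtain i where i: "i \<in> {1..n}" "card {j \<in> {1..n}. X j \<omega> < X i \<omega>} = k - 1"
      by (rule ex_order_stat_index[where X=X and \<omega>=\<omega>]) (use w in blast)+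
    have neq: "X j \<omega> \<noteq> X i \<omega>" if "j \<in> {1..n} - {i}" for j
      using w(1) i(1) that by (auto dest: inj_onD)
    define A where "A = {j \<in> {1..n}. X j \<omega> < X i \<omega>}"
    define B where "B = {j \<in> {1..n}. X i \<omega> < X j \<omega> \<and> g (X i \<omega>) < X j \<omega>}"
    have "(i, A, B) \<in> T UNIV" using i by (auto simp: T_def A_def B_def)
    moreover have "P A B j (X i \<omega>) (X j \<omega>)" if "j \<in> {1..n} - {i}" for j
      using neq[OF that] that by (auto simp: P_def A_def B_def)
    then have "\<omega> \<in> E (i, A, B)" using w by (auto simp: E_def)
    ultimately show "\<exists>i A B. (i, A, B) \<in> T UNIV \<and> \<omega> \<in> E (i, A, B) \<and> X i \<omega> \<le> g (X i \<omega>)"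
      using w i by blast
  qed
  have UnE: "(\<Union>t\<in>T L. E t) \<in> events" for L
    using finT Em by (intro sets.finite_UN) auto
  have "prob (\<Union>t\<in>T UNIV. E t) = 1"
    by (rule prob_eq_1[THEN iffD2, OF UnE]) (use ex in eventually_elim, blast)
  then have K: "K = 1" using prob_T[of UNIV] by simp
  have [measurable]: "order_stat X m n \<in> borel_measurable M" "order_stat X k n \<in> borel_measurable M"
    using k by (auto intro!: borel_measurable_order_stat)
  have "prob {\<omega> \<in> space M. order_stat X m n \<omega> \<le> g (order_stat X k n \<omega>)} =
      prob (\<Union>t\<in>T {..n - m}. E t)"
  proof (rule finite_measure_eq_AE)
    show "AE \<omega> in M. \<omega> \<in> {\<omega> \<in> space M. order_stat X m n \<omega> \<le> g (order_stat X k n \<omega>)} \<longleftrightarrow>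
        \<omega> \<in> (\<Union>t\<in>T {..n - m}. E t)"
      using ex good AE_space
    proof eventually_elim
      fix \<omega> assume "\<exists>i A B. (i, A, B) \<in> T UNIV \<and> \<omega> \<in> E (i, A, B) \<and> X i \<omega> \<le> g (X i \<omega>)"
        and good: "inj_on (\<lambda>j. X j \<omega>) {1..n} \<and> (\<forall>i\<in>{1..n}. X i \<omega> \<le> g (X i \<omega>))"
        and sp: "\<omega> \<in> space M"
      then obtain i A B where iAB: "(i, A, B) \<in> T UNIV" "\<omega> \<in> E (i, A, B)" "X i \<omega> \<le> g (X i \<omega>)"
        by blast
      show "\<omega> \<in> {\<omega> \<in> space M. order_stat X m n \<omega> \<le> g (order_stat X k n \<omega>)} \<longleftrightarrow>
        \<omega> \<in> (\<Union>t\<in>T {..n - m}. E t)"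
      proof
        assume "\<omega> \<in> {\<omega> \<in> space M. order_stat X m n \<omega> \<le> g (order_stat X k n \<omega>)}"
        then have "card B \<le> n - m" using E_k[OF iAB(1,2)] E_m[OF iAB] by simp
        then have "(i, A, B) \<in> T {..n - m}" using iAB(1) by (auto simp: T_def)
        then show "\<omega> \<in> (\<Union>t\<in>T {..n - m}. E t)" using iAB(2) by blast
      next
        assume "\<omega> \<in> (\<Union>t\<in>T {..n - m}. E t)"
        then obtain i A B where t: "(i, A, B) \<in> T {..n - m}" "\<omega> \<in> E (i, A, B)" by auto
        then have "X i \<omega> \<le> g (X i \<omega>)" "card B \<le> n - m" using good by (auto simp: T_def)
        then show "\<omega> \<in> {\<omega> \<in> space M. order_stat X m n \<omega> \<le> g (order_stat X k n \<omega>)}"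
          using E_k[OF T_UNIV[OF t(1)] t(2)] E_m[OF T_UNIV[OF t(1)] t(2)] sp by simp
      qed
    qed
  qed (use UnE in measurable)
  then show ?thesis using prob_T[of "{..n - m}"] K by simp
qed

section \<open>The central limit theorem for binomial distributions\<close>

text \<open>The binomial threshold varies with \<open>k\<close>, so convergence at fixed points is
  not enough. By continuity a fixed point slightly left or right of \<open>b\<close> still has limit
  value beyond the given bound, and monotonicity carries this to \<open>a n\<close>.\<close>

lemma cdf_tendsto_moving_point:
  assumes \<mu>: "\<And>n. real_distribution (\<mu> n)" and conv: "weak_conv_m \<mu> M"
    and cont: "\<And>x. isCont (cdf M) x" and a: "(a \<longlongrightarrow> b) sequentially"
  shows "(\<lambda>n. cdf (\<mu> n) (a n)) \<longlonglongrightarrow> cdf M b"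
proof -
  have conv: "(\<lambda>n. cdf (\<mu> n) x) \<longlonglongrightarrow> cdf M x" for x
    using conv cont by (auto simp: weak_conv_m_def weak_conv_def)
  have mono: "cdf (\<mu> n) x \<le> cdf (\<mu> n) y" if "x \<le> y" for n x y
    using \<mu>[of n] that by (intro finite_borel_measure.cdf_nondecreasing)
      (auto simp: real_distribution_def finite_borel_measure_def finite_borel_measure_axioms_def
        real_distribution_axioms_def prob_space_def)
  show ?thesis
  proof (rule order_tendstoI)
    fix y assume "y < cdf M b"
    then have "\<forall>\<^sub>F x in at b. y < cdf M x"
      using cont[of b] by (auto simp: isCont_def intro: order_tendstoD)
    then have "\<forall>\<^sub>F x in at_left b. y < cdf M x" by (simp add: eventually_at_split)
    then have "\<exists>x. x < b \<and> y < cdf M x"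
      by (metis (mono_tags, lifting) eventually_at_left_field dense)
    then obtain x where x: "x < b" "y < cdf M x" by blast
    from order_tendstoD(1)[OF a x(1)] order_tendstoD(1)[OF conv x(2)]
    show "\<forall>\<^sub>F n in sequentially. y < cdf (\<mu> n) (a n)"
      by eventually_elim (meson mono less_imp_le less_le_trans)
  next
    fix y assume "cdf M b < y"
    then have "\<forall>\<^sub>F x in at b. cdf M x < y"
      using cont[of b] by (auto simp: isCont_def intro: order_tendstoD)
    then have "\<forall>\<^sub>F x in at_right b. cdf M x < y" by (simp add: eventually_at_split)
    then have "\<exists>x. b < x \<and> cdf M x < y"
      by (metis (mono_tags, lifting) eventually_at_right_field dense)
    then obtain x where x: "b < x" "cdf M x < y" by blast
    from order_tendstoD(2)[OF a x(1)] order_tendstoD(2)[OF conv x(2)]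
    show "\<forall>\<^sub>F n in sequentially. cdf (\<mu> n) (a n) < y"
      by eventually_elim (meson mono less_imp_le le_less_trans)
  qed
qed

text \<open>The success probability varies with \<open>k\<close>, which makes this a statement on
  triangular arrays. The characteristic function is compared with
  \<open>(1 - t^2 / (2 n))^n\<close>; the error is at most \<open>|t|^3 / 6\<close> divided by the
  standard deviation, so divergence of the variance suffices.\<close>

lemma weak_conv_m_binomial_pmf:
  fixes \<nu> :: "nat \<Rightarrow> nat" and p :: "nat \<Rightarrow> real"
  assumes var: "filterlim (\<lambda>k. real (\<nu> k) * (p k * (1 - p k))) at_top sequentially"
  shows "weak_conv_m
    (\<lambda>k. distr (binomial_pmf (\<nu> k) (p k)) borel
      (\<lambda>j. (real j - real (\<nu> k) * p k) / sqrt (real (\<nu> k) * (p k * (1 - p k)))))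
    std_normal_distribution"
proof (rule levy_continuity)
  show "real_distribution (distr (binomial_pmf (\<nu> k) (p k)) borel
      (\<lambda>j. (real j - real (\<nu> k) * p k) / sqrt (real (\<nu> k) * (p k * (1 - p k)))))" for k
    by (intro prob_space.real_distribution_distr prob_space_measure_pmf) simp
  show "real_distribution std_normal_distribution" by (rule real_dist_normal_dist)
  fix t :: real
  define v where "v k = real (\<nu> k) * (p k * (1 - p k))" for k
  define \<phi> where "\<phi> k = char (distr (binomial_pmf (\<nu> k) (p k)) borel
      (\<lambda>j. (real j - real (\<nu> k) * p k) / sqrt (v k))) t" for k
  have v_top: "filterlim v at_top sequentially" using var by (simp add: v_def[abs_def])
  \<comment> \<open>As \<open>v k\<close> is at most the number \<open>n\<close> of trials, the
    bound \<open>t^2 / 4\<close> guarantees that \<open>1 - t^2 / (2 n)\<close> lies in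
    \<open>[-1, 1]\<close>. Positivity of \<open>v k\<close> forces the success probability strictly
    between 0 and 1.\<close>
  have v_pos: "\<forall>\<^sub>F k in sequentially. v k > 0 \<and> v k \<ge> t\<^sup>2 / 4"
    using v_top by (intro eventually_conj)
      (blast intro: filterlim_at_top_dense[THEN iffD1, rule_format] filterlim_at_top[THEN iffD1, rule_format])+
  have "\<forall>\<^sub>F k in sequentially. cmod (\<phi> k - complex_of_real ((1 + (- t\<^sup>2 / 2) / \<nu> k) ^ \<nu> k)) \<le>
      \<bar>t\<bar> ^ 3 / 6 / sqrt (v k)"
    using v_pos
  proof eventually_elim
    fix k assume v: "v k > 0 \<and> v k \<ge> t\<^sup>2 / 4"
    define n q where "n = \<nu> k" and "q = p k"
    have vk: "v k = n * (q * (1 - q))" by (simp add: v_def n_def q_def)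
    have "q * (1 - q) > 0" using v by (simp add: vk zero_less_mult_iff)
    then have q: "0 < q" "q < 1" by (auto simp: zero_less_mult_iff)
    have n: "n > 0" using v by (auto simp: vk intro: Nat.gr0I)
    have "q * (1 - q) \<le> 1" using q by (intro mult_le_one) auto
    then have "v k \<le> real n * 1" unfolding vk by (intro mult_left_mono) auto
    then have n4: "t\<^sup>2 / 4 \<le> real n" using v by linarith
    define \<theta> where "\<theta> = t / sqrt (v k)"
    define Y where "Y b = (of_bool b - q :: real)" for b
    define \<psi> where "\<psi> = char (distr (bernoulli_pmf q) borel Y) \<theta>"
    have "t\<^sup>2 / (real n * w) * w = t\<^sup>2 / n" if "w \<noteq> 0" for w using that by simp
    from this[of "q * (1 - q)"] have \<theta>2: "\<theta>\<^sup>2 * (q * (1 - q)) = t\<^sup>2 / n"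
      using v q by (simp add: \<theta>_def power_divide vk)
    have \<psi>: "\<psi> = q * iexp (\<theta> * (1 - q)) + (1 - q) * iexp (- \<theta> * q)"
      unfolding \<psi>_def char_def using q
      by (subst integral_distr) (simp_all add: integral_measure_pmf[of UNIV] UNIV_bool Y_def scaleR_conv_of_real)
    \<comment> \<open>The binomial theorem exhibits this sum as the \<open>n\<close>-th power of the
      characteristic function of one centred Bernoulli variable, without constructing independent
      summands.\<close>
    have "\<phi> k = (\<Sum>j\<le>n. (real (n choose j) * q ^ j * (1 - q) ^ (n - j)) *\<^sub>R iexp (\<theta> * (real j - real n * q)))"
      unfolding \<phi>_def char_def using q
      by (subst integral_distr) (simp_all add: expectation_binomial_pmf' \<theta>_def n_def q_def)
    also have "\<dots> = (\<Sum>j\<le>n. of_nat (n choose j) * (q * iexp (\<theta> * (1 - q))) ^ j * ((1 - q) * iexp (- \<theta> * q)) ^ (n - j))"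
    proof (rule sum.cong[OF refl])
      fix j assume "j \<in> {..n}"
      then have j: "real n = real j + real (n - j)" by (simp add: of_nat_diff)
      have "iexp (\<theta> * (real j - real n * q)) = iexp (\<theta> * (1 - q)) ^ j * iexp (- \<theta> * q) ^ (n - j)"
        unfolding j by (simp add: exp_of_nat_mult[symmetric] exp_add[symmetric] algebra_simps)
      then show "(real (n choose j) * q ^ j * (1 - q) ^ (n - j)) *\<^sub>R iexp (\<theta> * (real j - real n * q)) =
          of_nat (n choose j) * (q * iexp (\<theta> * (1 - q))) ^ j * ((1 - q) * iexp (- \<theta> * q)) ^ (n - j)"
        by (simp add: scaleR_conv_of_real power_mult_distrib)
    qed
    also have "\<dots> = \<psi> ^ n" unfolding \<psi> by (rule binomial_ring[symmetric])
    finally have \<phi>: "\<phi> k = \<psi> ^ n" .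

    \<comment> \<open>The centred Bernoulli variable has mean 0 and variance
      \<open>q * (1 - q)\<close>, so \<open>1 - t^2 / (2 n)\<close> is the second-order Taylor
      polynomial of its characteristic function at the rescaled argument.\<close>
    have eq: "1 + (- t\<^sup>2 / 2) / n = 1 - \<theta>\<^sup>2 * (q * (1 - q)) / 2" unfolding \<theta>2 by simp
    have "cmod (\<psi> - (1 - \<theta>\<^sup>2 * (q * (1 - q)) / 2)) \<le>
        \<theta>\<^sup>2 / 6 * measure_pmf.expectation (bernoulli_pmf q) (\<lambda>b. min (6 * (Y b)\<^sup>2) (\<bar>\<theta>\<bar> * \<bar>Y b\<bar> ^ 3))"
      unfolding \<psi>_def
      by (rule prob_space.char_approx3'[OF prob_space_measure_pmf _ _ _ _ _ refl])
        (use q in \<open>auto simp: Y_def power2_eq_square algebra_simps intro!: integrable_measure_pmf_finite\<close>)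
    \<comment> \<open>The minimum is bounded by its cubic entry, and the third absolute moment
      \<open>q * (1 - q) * ((1 - q)^2 + q^2)\<close> is at most the variance.\<close>
    also have "\<dots> \<le> \<theta>\<^sup>2 / 6 * (\<bar>\<theta>\<bar> * (q * (1 - q)))"
    proof (rule mult_left_mono)
      have "measure_pmf.expectation (bernoulli_pmf q) (\<lambda>b. min (6 * (Y b)\<^sup>2) (\<bar>\<theta>\<bar> * \<bar>Y b\<bar> ^ 3)) \<le>
          \<bar>\<theta>\<bar> * \<bar>1 - q\<bar> ^ 3 * q + \<bar>\<theta>\<bar> * \<bar>- q\<bar> ^ 3 * (1 - q)"
        using q by (subst integral_bernoulli_pmf) (auto simp: Y_def intro!: add_mono mult_right_mono)
      also have "\<dots> = \<bar>\<theta>\<bar> * (q * (1 - q) * ((1 - q)\<^sup>2 + q\<^sup>2))"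
        using q by (simp add: power2_eq_square power3_eq_cube algebra_simps)
      also have "\<dots> \<le> \<bar>\<theta>\<bar> * (q * (1 - q) * 1)"
      proof (intro mult_left_mono)
        have "(1 - q)\<^sup>2 + q\<^sup>2 = 1 - 2 * (q * (1 - q))" by (simp add: power2_eq_square algebra_simps)
        then show "(1 - q)\<^sup>2 + q\<^sup>2 \<le> 1" using q by simp
      qed (use q in auto)
      finally show "measure_pmf.expectation (bernoulli_pmf q) (\<lambda>b. min (6 * (Y b)\<^sup>2) (\<bar>\<theta>\<bar> * \<bar>Y b\<bar> ^ 3)) \<le>
          \<bar>\<theta>\<bar> * (q * (1 - q))" by simp
    qed simp
    also have "\<dots> = \<bar>\<theta>\<bar> / 6 * (\<theta>\<^sup>2 * (q * (1 - q)))" by simp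
    also have "\<dots> = \<bar>t\<bar> ^ 3 / 6 / sqrt (v k) / n"
      unfolding \<theta>2 using v by (simp add: \<theta>_def power3_eq_cube power2_eq_square abs_mult[symmetric])
    finally have step: "cmod (\<psi> - complex_of_real (1 + (- t\<^sup>2 / 2) / n)) \<le> \<bar>t\<bar> ^ 3 / 6 / sqrt (v k) / n"
      unfolding eq by simp
    interpret Y: real_distribution "distr (bernoulli_pmf q) borel Y"
      by (intro prob_space.real_distribution_distr prob_space_measure_pmf) simp
    \<comment> \<open>Both bases lie in the closed unit disc, so passing to \<open>n\<close>-th
      powers costs a factor \<open>n\<close>, which cancels the \<open>1 / n\<close> of the one-step
      error.\<close>
    have "cmod (\<psi> ^ n - complex_of_real (1 + (- t\<^sup>2 / 2) / n) ^ n) \<le>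
        n * cmod (\<psi> - complex_of_real (1 + (- t\<^sup>2 / 2) / n))"
    proof (rule norm_power_diff)
      show "cmod \<psi> \<le> 1" unfolding \<psi>_def by (rule Y.cmod_char_le_1)
      have "\<bar>1 + (- t\<^sup>2 / 2) / n\<bar> \<le> 1" using n n4 by (intro abs_leI) (auto simp: field_simps)
      then show "cmod (complex_of_real (1 + (- t\<^sup>2 / 2) / n)) \<le> 1" unfolding norm_of_real by simp
    qed
    also have "\<dots> \<le> n * (\<bar>t\<bar> ^ 3 / 6 / sqrt (v k) / n)" using step by (rule mult_left_mono) simp
    finally show "cmod (\<phi> k - complex_of_real ((1 + (- t\<^sup>2 / 2) / \<nu> k) ^ \<nu> k)) \<le> \<bar>t\<bar> ^ 3 / 6 / sqrt (v k)"
      using n by (simp add: \<phi> n_def)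
  qed
  moreover have "(\<lambda>k. \<bar>t\<bar> ^ 3 / 6 / sqrt (v k)) \<longlonglongrightarrow> 0"
    by (intro tendsto_divide_0[OF tendsto_const] filterlim_at_top_imp_at_infinity
        filterlim_compose[OF sqrt_at_top v_top])
  ultimately have "(\<lambda>k. \<phi> k - complex_of_real ((1 + (- t\<^sup>2 / 2) / \<nu> k) ^ \<nu> k)) \<longlonglongrightarrow> 0"
    by (rule Lim_null_comparison)
  moreover have "(\<lambda>k. complex_of_real ((1 + (- t\<^sup>2 / 2) / \<nu> k) ^ \<nu> k)) \<longlonglongrightarrow> complex_of_real (exp (- t\<^sup>2 / 2))"
  proof (rule tendsto_of_real, rule filterlim_compose[OF tendsto_exp_limit_sequentially])
    have "\<forall>\<^sub>F k in sequentially. v k \<le> real (\<nu> k)"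
    proof (rule always_eventually, rule allI)
      fix k
      \<comment> \<open>Completing the square bounds the variance by the number of trials, which
        therefore also diverges.\<close>
      have "p k * (1 - p k) = 1 / 4 - (p k - 1 / 2)\<^sup>2" by (simp add: power2_eq_square algebra_simps)
      then have "p k * (1 - p k) \<le> 1" using zero_le_power2[of "p k - 1 / 2"] by linarith
      then show "v k \<le> real (\<nu> k)" unfolding v_def by (simp add: mult_left_le)
    qed
    with v_top have "filterlim (\<lambda>k. real (\<nu> k)) at_top sequentially" by (rule filterlim_at_top_mono)
    then show "filterlim \<nu> sequentially sequentially" by (simp add: filterlim_sequentially_iff_filterlim_real)
  qed
  ultimately have "\<phi> \<longlonglongrightarrow> complex_of_real (exp (- t\<^sup>2 / 2))"
    by (rule Lim_transform[rotated])
  then show "(\<lambda>k. char (distr (binomial_pmf (\<nu> k) (p k)) borel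
      (\<lambda>j. (real j - real (\<nu> k) * p k) / sqrt (real (\<nu> k) * (p k * (1 - p k))))) t)
      \<longlonglongrightarrow> char std_normal_distribution t"
    by (simp add: \<phi>_def[abs_def] v_def char_std_normal_distribution)
qed

section \<open>Pareto samples\<close>

lemma (in real_distribution) measure_greaterThan: "measure M {x<..} = 1 - cdf M x"
proof -
  have "measure M {x<..} = measure M (space M - {..x})" by (intro arg_cong[where f="measure M"]) auto
  then show ?thesis unfolding cdf_def by (subst (asm) prob_compl) auto
qed

text \<open>With \<open>max\<close> the two cases merge into a single visibly continuous formula,
  from which the absence of atoms is deduced later.\<close>

lemma pareto_rv_cdf:
  assumes "\<delta> > 0" "pareto_rv M \<alpha> \<delta> X"
  shows "cdf (distr M borel X) = (\<lambda>x. 1 - (\<delta> / max x \<delta>) powr \<alpha>)"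
  using assms by (auto simp: pareto_rv_def max_def fun_eq_iff)

text \<open>The binomial law is applied with \<open>g x = exp t * x\<close>. Above \<delta> the
  Pareto tail is a power with exponent -\<alpha>, so scaling the level by \<open>exp t\<close>
  multiplies it by \<open>exp (- \<alpha> * t)\<close>. The sign of \<open>t\<close> gives
  \<open>x \<le> g x\<close> and keeps this factor at most 1.\<close>

lemma prob_log_order_stat_ratio_le:
  assumes \<alpha>: "\<alpha> > 0" and \<delta>: "\<delta> > 0" and sample: "pareto_sample M \<alpha> \<delta> n X"
    and k: "1 \<le> k" "k < m" "m \<le> n" and t: "t \<ge> 0"
  shows "measure M {\<omega> \<in> space M. ln (order_stat X m n \<omega> / order_stat X k n \<omega>) \<le> t} =
    measure (binomial_pmf (n - k) (exp (- \<alpha> * t))) {..n - m}"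
proof -
  interpret prob_space M using sample by (simp add: pareto_sample_def)
  have indep: "indep_vars (\<lambda>_. borel) X {1..n}" using sample by (simp add: pareto_sample_def)
  have par: "pareto_rv M \<alpha> \<delta> (X j)" if "j \<in> {1..n}" for j
    using sample that by (simp add: pareto_sample_def)
  have X: "random_variable borel (X j)" if "j \<in> {1..n}" for j
    using par[OF that] by (simp add: pareto_rv_def)
  define D where "D = distr M borel (X 1)"
  have cdf: "cdf D x = 1 - (\<delta> / max x \<delta>) powr \<alpha>" for x
    unfolding D_def using pareto_rv_cdf[OF \<delta> par[of 1]] k by simp
  interpret D: real_distribution D
    unfolding D_def by (rule real_distribution_distr) (use X k in auto)
  have distr: "distr M borel (X j) = D" if "j \<in> {1..n}" for j
    unfolding D_def using that k pareto_rv_cdf[OF \<delta> par[of j]] pareto_rv_cdf[OF \<delta> par[of 1]]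
    by (intro cdf_unique real_distribution_distr X) auto
  have gt: "AE x in D. \<delta> < x"
  proof -
    have "measure D {..\<delta>} = 0" using cdf[of \<delta>] \<delta> by (simp add: cdf_def)
    then have "emeasure D {x \<in> space D. \<not> \<delta> < x} = 0"
      by (simp add: D.emeasure_eq_measure not_less atMost_def)
    then show ?thesis by (subst AE_iff_measurable[OF _ refl]) auto
  qed
  have "emeasure D {x} = 0" for x
  proof -
    have "cdf D = (\<lambda>x. 1 - (\<delta> / max x \<delta>) powr \<alpha>)" using cdf by auto
    moreover have "isCont (\<lambda>x. 1 - (\<delta> / max x \<delta>) powr \<alpha>) x"
      using \<delta> by (intro continuous_intros) auto
    ultimately show ?thesis using D.isCont_cdf[of x] by (simp add: D.emeasure_eq_measure)
  qed
  moreover have "AE x in D. x \<le> exp t * x"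
    using gt
  proof eventually_elim
    fix x assume "\<delta> < x"
    then show "x \<le> exp t * x" using t \<delta> mult_right_mono[of 1 "exp t" x] by simp
  qed
  moreover have "AE x in D. measure D {exp t * x<..} = exp (- \<alpha> * t) * measure D {x<..}"
    using gt
  proof eventually_elim
    fix x assume x: "\<delta> < x"
    then have "x \<le> exp t * x" using t \<delta> mult_right_mono[of 1 "exp t" x] by simp
    then have "\<delta> \<le> exp t * x" using x by linarith
    with x have "max (exp t * x) \<delta> = exp t * x" "max x \<delta> = x" by auto
    moreover have "(\<delta> / (exp t * x)) powr \<alpha> = exp (- \<alpha> * t) * (\<delta> / x) powr \<alpha>"
      using x \<delta> by (simp add: powr_def ln_div ln_mult exp_add[symmetric] algebra_simps)
    ultimately show "measure D {exp t * x<..} = exp (- \<alpha> * t) * measure D {x<..}"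
      by (simp add: D.measure_greaterThan cdf)
  qed
  ultimately have *: "prob {\<omega> \<in> space M. order_stat X m n \<omega> \<le> exp t * order_stat X k n \<omega>} =
      measure (binomial_pmf (n - k) (exp (- \<alpha> * t))) {..n - m}"
    using t \<alpha> by (intro prob_order_stat_le_order_stat[OF k indep distr]) auto

  have [measurable]: "order_stat X m n \<in> borel_measurable M" "order_stat X k n \<in> borel_measurable M"
    using k X by (auto intro!: borel_measurable_order_stat)
  \<comment> \<open>Almost surely all observations exceed \<delta>, so both order statistics are
    positive and the inequality between logarithms can be exponentiated.\<close>
  have "AE \<omega> in M. \<forall>j\<in>{1..n}. \<delta> < X j \<omega>"
  proof (intro AE_finite_allI finite_atLeastAtMost)
    fix j assume j: "j \<in> {1..n}"
    show "AE \<omega> in M. \<delta> < X j \<omega>"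
      by (rule AE_distrD[OF X[OF j]]) (simp only: distr[OF j] gt)
  qed
  then have "AE \<omega> in M. \<omega> \<in> {\<omega> \<in> space M. ln (order_stat X m n \<omega> / order_stat X k n \<omega>) \<le> t} \<longleftrightarrow>
      \<omega> \<in> {\<omega> \<in> space M. order_stat X m n \<omega> \<le> exp t * order_stat X k n \<omega>}"
  proof eventually_elim
    fix \<omega> assume pos: "\<forall>j\<in>{1..n}. \<delta> < X j \<omega>"
    have os: "order_stat X i n \<omega> > 0" if "1 \<le> i" "i \<le> n" for i
    proof -
      have none: "{j \<in> {1..n}. X j \<omega> \<le> 0} = {}" using pos \<delta> by force
      then have "\<not> order_stat X i n \<omega> \<le> 0"
        unfolding order_stat_le_iff[OF that, of X \<omega> 0] none using that by simp
      then show ?thesis by simp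
    qed
    have pos2: "order_stat X m n \<omega> > 0" "order_stat X k n \<omega> > 0" using k by (auto intro: os)
    then have "ln (order_stat X m n \<omega> / order_stat X k n \<omega>) \<le> t \<longleftrightarrow>
        order_stat X m n \<omega> / order_stat X k n \<omega> \<le> exp t"
      using ln_le_cancel_iff[of "order_stat X m n \<omega> / order_stat X k n \<omega>" "exp t"]
      by (simp only: ln_exp exp_gt_zero divide_pos_pos)
    also have "\<dots> \<longleftrightarrow> order_stat X m n \<omega> \<le> exp t * order_stat X k n \<omega>"
      using pos2 by (simp add: pos_divide_le_eq)
    finally show "\<omega> \<in> {\<omega> \<in> space M. ln (order_stat X m n \<omega> / order_stat X k n \<omega>) \<le> t} \<longleftrightarrow>
      \<omega> \<in> {\<omega> \<in> space M. order_stat X m n \<omega> \<le> exp t * order_stat X k n \<omega>}" by simp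
  qed
  then have "prob {\<omega> \<in> space M. ln (order_stat X m n \<omega> / order_stat X k n \<omega>) \<le> t} =
      prob {\<omega> \<in> space M. order_stat X m n \<omega> \<le> exp t * order_stat X k n \<omega>}"
    by (rule finite_measure_eq_AE) measurable
  with * show ?thesis by simp
qed

section \<open>Distribution function of the normal law\<close>

lemma cdf_normal_law:
  assumes v: "v > 0"
  shows "cdf (normal_law 0 v) x = cdf std_normal_distribution (x / sqrt v)"
proof -
  interpret S: real_distribution std_normal_distribution by (rule real_dist_normal_dist)
  have "distributed std_normal_distribution lborel (\<lambda>x. x) std_normal_density"
    unfolding distributed_def by (auto simp: distr_id2)
  from S.normal_density_affine[OF this, of "sqrt v" 0]
  have "distr std_normal_distribution lborel (\<lambda>x. sqrt v * x) = normal_law 0 v"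
    using v by (simp add: distributed_def normal_law_def)
  then have "cdf (normal_law 0 v) x = cdf (distr std_normal_distribution lborel (\<lambda>x. sqrt v * x)) x"
    by simp
  also have "\<dots> = measure std_normal_distribution ((\<lambda>x. sqrt v * x) -` {..x})"
    unfolding cdf_def by (subst measure_distr) auto
  also have "(\<lambda>x. sqrt v * x) -` {..x} = {..x / sqrt v}"
    using v by (auto simp: field_simps)
  finally show ?thesis by (simp add: cdf_def)
qed

lemma isCont_cdf_std_normal: "isCont (cdf std_normal_distribution) x"
proof -
  interpret S: real_distribution std_normal_distribution by (rule real_dist_normal_dist)
  have "emeasure std_normal_distribution {x} = 0"
    by (subst emeasure_density) (auto simp: nn_integral_0_iff_AE intro!: AE_I[where N="{x}"] split: split_indicator)
  then show ?thesis by (simp add: S.isCont_cdf measure_def)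
qed

section \<open>Asymptotics of the binomial variance and threshold\<close>

text \<open>Here \<open>q\<close> is the success probability, \<open>k * s - 1\<close> the number of
  trials and \<open>k - 1\<close> the threshold. Expanding \<open>q\<close> around
  \<open>1 / s\<close>, the threshold exceeds the mean by about \<open>k * y / sqrt N\<close>, while
  the variance is about \<open>k * (s - 1) / s\<close> and \<open>N\<close> about
  \<open>k * (s + 1)\<close>.\<close>

lemma
  fixes s :: nat and y :: real
  assumes s: "s \<ge> 2"
  defines "N \<equiv> \<lambda>k. real (k * (s + 1) - 1)"
  defines "q \<equiv> \<lambda>k. exp (- y / sqrt (N k)) / s"
  defines "v \<equiv> \<lambda>k. real (k * s - 1) * (q k * (1 - q k))"
  shows binomial_variance_at_top: "filterlim v at_top sequentially"
    and binomial_threshold_tendsto: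
      "(\<lambda>k. (real (k - 1) - real (k * s - 1) * q k) / sqrt (v k)) \<longlonglongrightarrow> y * sqrt (s / ((real s)\<^sup>2 - 1))"
proof -
  \<comment> \<open>All limits are expressed in \<open>h = 1 / sqrt N\<close>.\<close>
  define h where "h k = 1 / sqrt (N k)" for k
  have N_eq: "\<forall>\<^sub>F k in sequentially. N k = real k * (real s + 1) - 1 \<and> N k > 0"
    using eventually_gt_at_top[of 0]
  proof eventually_elim
    case (elim k)
    then have "k * (s + 1) \<ge> k * 2" "k * 2 \<ge> 2" using s by (auto intro: mult_le_mono2)
    then have "1 < k * (s + 1)" by linarith
    moreover have "real (m - 1) = real m - 1" "1 < real m" if "1 < m" for m :: nat using that by auto
    ultimately have "N k = real (k * (s + 1)) - 1" "1 < real (k * (s + 1))" unfolding N_def by blast+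
    then show ?case by (simp add: algebra_simps)
  qed
  have "\<forall>\<^sub>F k in sequentially. real k \<le> N k"
    using N_eq eventually_gt_at_top[of 0]
  proof eventually_elim
    case (elim k)
    have "real k * 2 \<le> real k * real s" using s by (intro mult_left_mono) auto
    moreover have "N k = real k * real s + real k - 1" "1 \<le> real k"
      using elim by (simp_all add: algebra_simps)
    ultimately show ?case by linarith
  qed
  then have N_top: "filterlim N at_top sequentially"
    by (rule filterlim_at_top_mono[OF filterlim_real_sequentially])
  have h0: "h \<longlonglongrightarrow> 0" unfolding h_def
    by (intro tendsto_divide_0[OF tendsto_const] filterlim_at_top_imp_at_infinity
        filterlim_compose[OF sqrt_at_top N_top])
  have h_pos: "\<forall>\<^sub>F k in sequentially. h k > 0 \<and> (h k)\<^sup>2 * N k = 1"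
    using N_eq by eventually_elim (auto simp: h_def power_divide)
  have q_h: "q k = exp (- y * h k) / s" for k by (simp add: q_def h_def)
  have kh: "(\<lambda>k. real k * (h k)\<^sup>2) \<longlonglongrightarrow> 1 / (real s + 1)"
  proof (rule Lim_transform_eventually)
    have "(\<lambda>k. (1 + (h k)\<^sup>2) / (real s + 1)) \<longlonglongrightarrow> (1 + 0\<^sup>2) / (real s + 1)"
      by (intro tendsto_intros h0) simp
    then show "(\<lambda>k. (1 + (h k)\<^sup>2) / (real s + 1)) \<longlonglongrightarrow> 1 / (real s + 1)" by simp
    show "\<forall>\<^sub>F k in sequentially. (1 + (h k)\<^sup>2) / (real s + 1) = real k * (h k)\<^sup>2"
      using N_eq h_pos
    proof eventually_elim
      case (elim k)
      then have "(h k)\<^sup>2 * (real k * (real s + 1) - 1) = 1" by simp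
      then show ?case by (simp add: field_simps)
    qed
  qed
  have q_lim: "q \<longlonglongrightarrow> 1 / s"
  proof -
    have "(\<lambda>k. exp (- y * h k) / s) \<longlonglongrightarrow> exp (- y * 0) / s"
      by (intro tendsto_intros h0) (use s in simp)
    then show ?thesis by (simp add: q_h[abs_def])
  qed
  \<comment> \<open>This difference quotient tends to minus the derivative of
    \<open>exp (- y * z)\<close> at \<open>z = 0\<close>. Here \<open>h k\<close> must be eventually
    nonzero.\<close>
  have d_lim: "(\<lambda>k. (1 - exp (- y * h k)) / h k) \<longlonglongrightarrow> y"
  proof -
    have "((\<lambda>z. exp (- y * z)) has_real_derivative - y) (at 0)"
      by (auto intro!: derivative_eq_intros)
    then have "((\<lambda>z. (exp (- y * z) - 1) / z) \<longlongrightarrow> - y) (at 0)"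
      by (simp add: has_field_derivative_iff)
    moreover have "filterlim h (at 0) sequentially"
    proof -
      have "\<forall>\<^sub>F k in sequentially. h k \<noteq> 0" using h_pos by eventually_elim auto
      with h0 show ?thesis by (simp add: filterlim_at)
    qed
    ultimately have "(\<lambda>k. (exp (- y * h k) - 1) / h k) \<longlonglongrightarrow> - y" by (rule filterlim_compose)
    then have "(\<lambda>k. - ((exp (- y * h k) - 1) / h k)) \<longlonglongrightarrow> - (- y)" by (rule tendsto_minus)
    then show ?thesis by (simp add: divide_minus_left[symmetric] del: divide_minus_left)
  qed
  have ks: "\<forall>\<^sub>F k in sequentially. real (k * s - 1) = real k * real s - 1 \<and> real (k - 1) = real k - 1"
    using eventually_gt_at_top[of 0]
  proof eventually_elim
    case (elim k)
    then have "1 \<le> k * s" using s by simp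
    with elim show ?case by (simp add: of_nat_diff)
  qed
  \<comment> \<open>\<open>W\<close> is the limit of the variance divided by \<open>N\<close>, that
    is of \<open>s / (s + 1) * (1 / s) * (1 - 1 / s)\<close>.\<close>
  define W where "W = (real s - 1) / (s * (real s + 1))"
  have W: "W > 0" using s by (simp add: W_def)
  have vh: "(\<lambda>k. v k * (h k)\<^sup>2) \<longlonglongrightarrow> W"
  proof (rule Lim_transform_eventually)
    have "(\<lambda>k. (real k * (h k)\<^sup>2 * s - (h k)\<^sup>2) * (q k * (1 - q k))) \<longlonglongrightarrow>
        (1 / (real s + 1) * s - 0\<^sup>2) * (1 / s * (1 - 1 / s))"
      by (intro tendsto_intros kh q_lim h0)
    also have "(1 / (real s + 1) * s - 0\<^sup>2) * (1 / s * (1 - 1 / s)) = W"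
      using s by (simp add: W_def divide_simps)
    finally show "(\<lambda>k. (real k * (h k)\<^sup>2 * s - (h k)\<^sup>2) * (q k * (1 - q k))) \<longlonglongrightarrow> W" .
    show "\<forall>\<^sub>F k in sequentially. (real k * (h k)\<^sup>2 * s - (h k)\<^sup>2) * (q k * (1 - q k)) = v k * (h k)\<^sup>2"
      using ks
    proof eventually_elim
      case (elim k)
      then have e: "real (k * s - 1) = real k * real s - 1" ..
      show ?case unfolding v_def e by (simp add: algebra_simps)
    qed
  qed
  have "filterlim (\<lambda>k. v k * (h k)\<^sup>2 * N k) at_top sequentially"
    by (rule filterlim_tendsto_pos_mult_at_top[OF vh W N_top])
  then show "filterlim v at_top sequentially"
    by (rule filterlim_mono_eventually[OF _ order_refl order_refl])
      (use h_pos in \<open>eventually_elim, simp add: mult.assoc\<close>)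
  show "(\<lambda>k. (real (k - 1) - real (k * s - 1) * q k) / sqrt (v k)) \<longlonglongrightarrow> y * sqrt (s / ((real s)\<^sup>2 - 1))"
  proof (rule Lim_transform_eventually)
    \<comment> \<open>Numerator and denominator of the standardised threshold are both multiplied by
      \<open>h k\<close>, so that each has a finite limit. The numerator before scaling is
      \<open>k * (1 - s * q) - 1 + q\<close>, where \<open>s * q = exp (- y * h)\<close>.\<close>
    have "(\<lambda>k. (real k * (h k)\<^sup>2 * ((1 - exp (- y * h k)) / h k) - h k + h k * q k) / sqrt (v k * (h k)\<^sup>2))
        \<longlonglongrightarrow> (1 / (real s + 1) * y - 0 + 0 * (1 / s)) / sqrt W"
      by (intro tendsto_intros kh d_lim h0 q_lim vh) (use W in simp)
    also have "(1 / (real s + 1) * y - 0 + 0 * (1 / s)) / sqrt W = y * sqrt (s / ((real s)\<^sup>2 - 1))"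
    proof -
      have "(real s + 1) * sqrt W = sqrt ((real s + 1)\<^sup>2 * W)" by (simp add: real_sqrt_mult)
      also have "(real s + 1)\<^sup>2 * W = ((real s)\<^sup>2 - 1) / s"
        using s by (simp add: W_def power2_eq_square divide_simps) (simp add: algebra_simps)
      finally have "(real s + 1) * sqrt W = sqrt ((real s)\<^sup>2 - 1) / sqrt s" by (simp add: real_sqrt_divide)
      then have "y / ((real s + 1) * sqrt W) = y * (sqrt s / sqrt ((real s)\<^sup>2 - 1))" by simp
      then show ?thesis by (simp add: real_sqrt_divide)
    qed
    finally show "(\<lambda>k. (real k * (h k)\<^sup>2 * ((1 - exp (- y * h k)) / h k) - h k + h k * q k) / sqrt (v k * (h k)\<^sup>2))
        \<longlonglongrightarrow> y * sqrt (s / ((real s)\<^sup>2 - 1))" .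
    show "\<forall>\<^sub>F k in sequentially.
        (real k * (h k)\<^sup>2 * ((1 - exp (- y * h k)) / h k) - h k + h k * q k) / sqrt (v k * (h k)\<^sup>2) =
        (real (k - 1) - real (k * s - 1) * q k) / sqrt (v k)"
      using ks h_pos
    proof eventually_elim
      case (elim k)
      have E: "exp (- y * h k) = s * q k" using s by (simp add: q_h)
      have "real k * (h k)\<^sup>2 * ((1 - exp (- y * h k)) / h k) - h k + h k * q k =
          (real (k - 1) - real (k * s - 1) * q k) * h k"
      proof -
        have e: "real (k * s - 1) = real k * real s - 1" "real (k - 1) = real k - 1" using elim by blast+
        show ?thesis unfolding E e using elim by (simp add: field_simps power2_eq_square)
      qed
      moreover have "sqrt (v k * (h k)\<^sup>2) = sqrt (v k) * h k" using elim by (simp add: real_sqrt_mult)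
      ultimately show ?case using elim by simp
    qed
  qed
qed

section \<open>Limit laws of the log ratio and of its rescalings\<close>

text \<open>The free factor \<open>c\<close> covers all three statistics at once. The formula for
  \<open>Y\<close> is asked for \<open>k > 0\<close> only, because the harmonic difference in the
  second statistic vanishes at \<open>k = 0\<close>.\<close>

lemma weak_conv_log_order_stat_ratio:
  fixes M :: "nat \<Rightarrow> 'a measure"
    and X :: "nat \<Rightarrow> nat \<Rightarrow> 'a \<Rightarrow> real"
    and Y :: "nat \<Rightarrow> 'a \<Rightarrow> real"
    and \<alpha> \<delta> c :: real
    and s :: nat
  defines "N \<equiv> \<lambda>k. k * (s + 1) - 1"
  assumes \<alpha>: "\<alpha> > 0" and \<delta>: "\<delta> > 0" and s: "s \<ge> 2" and c: "c > 0"
    and sample: "\<And>n. pareto_sample (M n) \<alpha> \<delta> n (X n)"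
    and Y: "\<And>k \<omega>. k > 0 \<Longrightarrow> Y k \<omega> = c * (sqrt (real (N k)) *
      (ln (order_stat (X (N k)) (k * s) (N k) \<omega> / order_stat (X (N k)) k (N k) \<omega>) - 1 / \<alpha> * ln (real s)))"
  shows "weak_conv_m (\<lambda>k. distr (M (N k)) borel (Y k))
    (normal_law 0 (c\<^sup>2 * (((real s)\<^sup>2 - 1) / (real s * \<alpha>\<^sup>2))))"
  unfolding weak_conv_m_def weak_conv_def
proof (intro allI impI)
  fix x
  \<comment> \<open>The choice of \<open>y\<close> makes \<open>exp (- \<alpha> * t k)\<close> equal
    to \<open>q k\<close>, where \<open>t k\<close> is the level of the log ratio that corresponds
    to \<open>Y k \<le> x\<close>.\<close>
  define y where "y = \<alpha> * x / c"
  define q where "q k = exp (- y / sqrt (real (N k))) / s" for k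
  define v where "v k = real (k * s - 1) * (q k * (1 - q k))" for k
  define \<mu> where "\<mu> k = distr (binomial_pmf (k * s - 1) (q k)) borel
      (\<lambda>j. (real j - real (k * s - 1) * q k) / sqrt (v k))" for k
  define t where "t k = ln s / \<alpha> + x / (c * sqrt (real (N k)))" for k
  have v_top: "filterlim v at_top sequentially"
    using binomial_variance_at_top[OF s, of y] by (simp add: v_def[abs_def] q_def N_def)
  have "(\<lambda>k. cdf (\<mu> k) ((real (k - 1) - real (k * s - 1) * q k) / sqrt (v k)))
      \<longlonglongrightarrow> cdf std_normal_distribution (y * sqrt (s / ((real s)\<^sup>2 - 1)))"
  proof (rule cdf_tendsto_moving_point[OF _ _ isCont_cdf_std_normal])
    show "real_distribution (\<mu> k)" for k
      unfolding \<mu>_def by (intro prob_space.real_distribution_distr prob_space_measure_pmf) simp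
    show "weak_conv_m \<mu> std_normal_distribution"
      using weak_conv_m_binomial_pmf[of "\<lambda>k. k * s - 1" q] v_top by (simp add: \<mu>_def[abs_def] v_def[abs_def])
    show "(\<lambda>k. (real (k - 1) - real (k * s - 1) * q k) / sqrt (v k)) \<longlonglongrightarrow> y * sqrt (s / ((real s)\<^sup>2 - 1))"
      using binomial_threshold_tendsto[OF s, of y] by (simp add: v_def[abs_def] q_def N_def)
  qed
  moreover have "\<forall>\<^sub>F k in sequentially. cdf (distr (M (N k)) borel (Y k)) x =
      cdf (\<mu> k) ((real (k - 1) - real (k * s - 1) * q k) / sqrt (v k))"
  proof -
    have "filterlim (\<lambda>k. real (N k)) at_top sequentially"
    proof (rule filterlim_at_top_mono[OF filterlim_real_sequentially], rule always_eventually, rule allI)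
      fix k
      have "k * 2 \<le> k * s" using s by simp
      then have "k \<le> N k" unfolding N_def distrib_left by linarith
      then show "real k \<le> real (N k)" by simp
    qed
    then have "t \<longlonglongrightarrow> ln s / \<alpha> + 0" unfolding t_def
      by (intro tendsto_intros tendsto_divide_0[OF tendsto_const] filterlim_at_top_imp_at_infinity
          filterlim_tendsto_pos_mult_at_top[OF tendsto_const c] filterlim_compose[OF sqrt_at_top])
    \<comment> \<open>The binomial formula needs a nonnegative level. The limit
      \<open>ln s / \<alpha>\<close> is positive because \<open>s\<close> is at least 2.\<close>
    then have "\<forall>\<^sub>F k in sequentially. 0 < t k"
      by (rule order_tendstoD) (use s \<alpha> in simp)
    moreover have "\<forall>\<^sub>F k in sequentially. v k > 0"
      using v_top by (simp add: filterlim_at_top_dense)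
    ultimately show ?thesis
      using eventually_gt_at_top[of 0]
    proof eventually_elim
      case (elim k)
      have k: "1 \<le> k" "k < k * s" "k * s \<le> N k" "N k - k = k * s - 1" "N k - k * s = k - 1"
        using s elim by (auto simp: N_def algebra_simps)
      then have N_pos: "N k > 0" and kN: "k \<le> N k" by linarith+
      interpret P: prob_space "M (N k)" using sample by (simp add: pareto_sample_def)
      have X: "X (N k) j \<in> borel_measurable (M (N k))" if "j \<in> {1..N k}" for j
        using sample[of "N k"] that by (simp add: pareto_sample_def pareto_rv_def)
      have [measurable]: "order_stat (X (N k)) (k * s) (N k) \<in> borel_measurable (M (N k))"
          "order_stat (X (N k)) k (N k) \<in> borel_measurable (M (N k))"
        using k kN X by (auto intro!: borel_measurable_order_stat)
      have [measurable]: "Y k \<in> borel_measurable (M (N k))"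
        using elim by (subst measurable_cong[OF Y]) auto
      let ?L = "\<lambda>\<omega>. ln (order_stat (X (N k)) (k * s) (N k) \<omega> / order_stat (X (N k)) k (N k) \<omega>)"
      have "cdf (distr (M (N k)) borel (Y k)) x = measure (M (N k)) (Y k -` {..x} \<inter> space (M (N k)))"
        unfolding cdf_def by (subst measure_distr) auto
      also have "Y k -` {..x} \<inter> space (M (N k)) = {\<omega> \<in> space (M (N k)). ?L \<omega> \<le> t k}"
      proof -
        have "c * (sqrt (real (N k)) * (l - 1 / \<alpha> * ln (real s))) \<le> x \<longleftrightarrow> l \<le> t k" for l
        proof -
          have "c * (sqrt (real (N k)) * (l - 1 / \<alpha> * ln (real s))) \<le> x \<longleftrightarrow>
              l - 1 / \<alpha> * ln (real s) \<le> x / (c * sqrt (real (N k)))"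
            using c N_pos by (simp add: pos_le_divide_eq mult_ac)
          then show ?thesis by (auto simp: t_def)
        qed
        then show ?thesis using Y elim by auto
      qed
      also have "measure (M (N k)) \<dots> = measure (binomial_pmf (k * s - 1) (exp (- \<alpha> * t k))) {..k - 1}"
        using prob_log_order_stat_ratio_le[OF \<alpha> \<delta> sample[of "N k"] k(1-3), of "t k"] elim k(4,5) by simp
      also have "exp (- \<alpha> * t k) = q k"
      proof -
        have "- \<alpha> * t k = - ln s + (- y / sqrt (real (N k)))"
          using \<alpha> by (simp add: t_def y_def field_simps)
        then have "exp (- \<alpha> * t k) = exp (- ln s) * exp (- y / sqrt (real (N k)))"
          by (simp only: exp_add)
        then show ?thesis using s by (simp add: q_def exp_minus inverse_eq_divide)
      qed
      also have "measure (binomial_pmf (k * s - 1) (q k)) {..k - 1} =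
          cdf (\<mu> k) ((real (k - 1) - real (k * s - 1) * q k) / sqrt (v k))"
      proof -
        \<comment> \<open>Standardisation is strictly increasing since \<open>v k > 0\<close>, so
          the event is the preimage of a half-line.\<close>
        have "{..k - 1} = (\<lambda>j. (real j - real (k * s - 1) * q k) / sqrt (v k)) -`
            {..(real (k - 1) - real (k * s - 1) * q k) / sqrt (v k)}"
          using elim by (auto simp: divide_le_cancel)
        then show ?thesis unfolding cdf_def \<mu>_def by (subst measure_distr) auto
      qed
      finally show ?case .
    qed
  qed
  ultimately have "(\<lambda>k. cdf (distr (M (N k)) borel (Y k)) x)
      \<longlonglongrightarrow> cdf std_normal_distribution (y * sqrt (s / ((real s)\<^sup>2 - 1)))"
    by (simp add: tendsto_cong)
  moreover have "cdf (normal_law 0 (c\<^sup>2 * (((real s)\<^sup>2 - 1) / (real s * \<alpha>\<^sup>2)))) x =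
      cdf std_normal_distribution (y * sqrt (s / ((real s)\<^sup>2 - 1)))"
  proof -
    have s1: "(real s)\<^sup>2 - 1 > 0" using one_less_power[of "real s" 2] s by simp
    have "x / sqrt (c\<^sup>2 * (((real s)\<^sup>2 - 1) / (real s * \<alpha>\<^sup>2))) = y * sqrt (s / ((real s)\<^sup>2 - 1))"
      using c \<alpha> s s1 by (simp add: y_def real_sqrt_mult real_sqrt_divide)
    then show ?thesis using c \<alpha> s s1 by (subst cdf_normal_law) auto
  qed
  ultimately show "(\<lambda>k. cdf (distr (M (N k)) borel (Y k)) x)
      \<longlonglongrightarrow> cdf (normal_law 0 (c\<^sup>2 * (((real s)\<^sup>2 - 1) / (real s * \<alpha>\<^sup>2)))) x" by simp
qed

theorem theorem4:
  fixes M :: "nat \<Rightarrow> 'a measure"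
    and X :: "nat \<Rightarrow> nat \<Rightarrow> 'a \<Rightarrow> real"
    and \<alpha> \<delta> :: real
    and s :: nat
  defines "N \<equiv> \<lambda>k. k * (s + 1) - 1"
  assumes "\<alpha> > 0" and "\<delta> > 0" and "s \<ge> 2"
    and "\<And>n. pareto_sample (M n) \<alpha> \<delta> n (X n)"
  shows
    "weak_conv_m
       (\<lambda>k. distr (M (N k)) borel
         (\<lambda>\<omega>. sqrt (real (N k)) *
           (ln (order_stat (X (N k)) (k * s) (N k) \<omega> / order_stat (X (N k)) k (N k) \<omega>)
             - 1 / \<alpha> * ln (real s))))
       (normal_law 0 (((real s)\<^sup>2 - 1) / (real s * \<alpha>\<^sup>2)))
     \<and> weak_conv_m
       (\<lambda>k. distr (M (N k)) borel
         (\<lambda>\<omega>. sqrt (real (N k)) * (harm (k * s - 1) - harm (k - 1)) *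
           (\<alpha> * Q_stat (X (N k)) k s \<omega>
             - ln (real s) / (harm (k * s - 1) - harm (k - 1)))))
       (normal_law 0 (((real s)\<^sup>2 - 1) / real s))
     \<and> weak_conv_m
       (\<lambda>k. distr (M (N k)) borel
         (\<lambda>\<omega>. sqrt (real (N k)) * (\<alpha> * Q_star_stat (X (N k)) k s \<omega> - 1)))
       (normal_law 0 (((real s)\<^sup>2 - 1) / (real s * (ln (real s))\<^sup>2)))"
proof (intro conjI)
  note main = weak_conv_log_order_stat_ratio[OF assms(2-4) _ assms(5)]
  have N: "(s + 1) * k - 1 = N k" for k by (simp add: N_def mult.commute)
  have ln_s: "ln (real s) > 0" using assms(4) by simp
  \<comment> \<open>Each variance is brought to the form \<open>c^2\<close> times the variance of
    the first limit, as the common limit theorem produces it.\<close>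
  have v: "((real s)\<^sup>2 - 1) / (real s * \<alpha>\<^sup>2) = 1\<^sup>2 * (((real s)\<^sup>2 - 1) / (real s * \<alpha>\<^sup>2))"
    "((real s)\<^sup>2 - 1) / real s = \<alpha>\<^sup>2 * (((real s)\<^sup>2 - 1) / (real s * \<alpha>\<^sup>2))"
    "((real s)\<^sup>2 - 1) / (real s * (ln (real s))\<^sup>2) =
      (\<alpha> / ln (real s))\<^sup>2 * (((real s)\<^sup>2 - 1) / (real s * \<alpha>\<^sup>2))"
    using assms(2) by (simp_all add: power_divide)
  show "weak_conv_m
       (\<lambda>k. distr (M (N k)) borel
         (\<lambda>\<omega>. sqrt (real (N k)) *
           (ln (order_stat (X (N k)) (k * s) (N k) \<omega> / order_stat (X (N k)) k (N k) \<omega>)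
             - 1 / \<alpha> * ln (real s))))
       (normal_law 0 (((real s)\<^sup>2 - 1) / (real s * \<alpha>\<^sup>2)))"
    by (subst v(1), unfold N_def, rule main) auto
  show "weak_conv_m
       (\<lambda>k. distr (M (N k)) borel
         (\<lambda>\<omega>. sqrt (real (N k)) * (harm (k * s - 1) - harm (k - 1)) *
           (\<alpha> * Q_stat (X (N k)) k s \<omega>
             - ln (real s) / (harm (k * s - 1) - harm (k - 1)))))
       (normal_law 0 (((real s)\<^sup>2 - 1) / real s))"
    unfolding v(2) unfolding N_def
  proof (rule main, goal_cases)
    case (2 k \<omega>)
    \<comment> \<open>For \<open>k > 0\<close> and \<open>s\<close> at least 2 the harmonic
      difference is strictly positive, so it can be cancelled.\<close>
    have "k * 2 \<le> k * s" using assms(4) by simp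
    then have "k - 1 < k * s - 1" using 2 by linarith
    then have "harm (Suc (k - 1)) \<le> (harm (k * s - 1) :: real)" by (intro harm_mono) simp
    then have "harm (k - 1) < (harm (k * s - 1) :: real)"
      unfolding harm_Suc by (smt (verit) of_nat_0_less_iff positive_imp_inverse_positive zero_less_Suc)
    moreover have scale: "r * H * (\<alpha> * (L / H) - l / H) = \<alpha> * (r * (L - 1 / \<alpha> * l))" if "H \<noteq> 0" for r H L l
      using that assms(2) by (simp add: field_simps)
    ultimately show ?case unfolding Q_stat_def N unfolding N_def by (intro scale) simp
  qed (use assms in simp)
  show "weak_conv_m
       (\<lambda>k. distr (M (N k)) borel
         (\<lambda>\<omega>. sqrt (real (N k)) * (\<alpha> * Q_star_stat (X (N k)) k s \<omega> - 1)))
       (normal_law 0 (((real s)\<^sup>2 - 1) / (real s * (ln (real s))\<^sup>2)))"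
    unfolding v(3) unfolding N_def
  proof (rule main, goal_cases)
    case (2 k \<omega>)
    have scale: "r * (\<alpha> * (L / l) - 1) = \<alpha> / l * (r * (L - 1 / \<alpha> * l))" if "l \<noteq> 0" for r L l
      using that assms(2) by (simp add: field_simps)
    show ?case unfolding Q_star_stat_def N unfolding N_def by (rule scale) (use ln_s in simp)
  qed (use assms ln_s in simp)
qed

end
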